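(* Assume $\mu=1$, and for $\varepsilon\in(0,1)$ put $\gamma(\varepsilon):=\dfrac{\log(1/\varepsilon)}{\log a}$. Then there exists $\lambda>0$ such that $$\limsup_{\varepsilon\downarrow 0}\ \mathbb{P}\big(|K-\gamma(\varepsilon)|\ge x \,\big|\, W<\varepsilon\big)\le e^{-\lambda x}\qquad\text{for all } x\ge 1.$$
   Context: $(Z_n)_{n\ge 0}$ is the sequence of generation sizes of a Galton–Watson tree with $Z_0=1$ whose offspring variable $N$ (values in $\{0,1,2,\dots\}$) is nondegenerate (not almost surely constant), with $P(N=0)=0$ and $E[N\log N]<\infty$. Put $p_n:=P(N=n)$, $a:=E[N]\in(1,\infty)$ and $\mu:=\min\{n\in\mathbb{N}: p_n>0\}$. The martingale limit is $W:=\lim_{n\to\infty}Z_n/a^n$, which exists and is strictly positive almost surely (and $\mathbb{P}(W<\varepsilon)>0$ for every $\varepsilon>0$). Let $K:=\min\{k\in\mathbb{N}: Z_k>\mu^k\}$. *)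

theory Defs
  imports "HOL-Probability.Probability"
begin

text \<open>
  Galton--Watson tree in Ulam--Harris notation: individuals are finite words over the naturals, the
  root is the empty word, and the children of \<open>u\<close> are \<open>u @ [i]\<close> with \<open>i < \<nu> u\<close>, where \<open>\<nu> u\<close> is
  the number of offspring of \<open>u\<close>.
\<close>
inductive_set gw_tree :: "(nat list \<Rightarrow> nat) \<Rightarrow> nat list set" for \<nu> :: "nat list \<Rightarrow> nat" where
  root: "[] \<in> gw_tree \<nu>"
| child: "u \<in> gw_tree \<nu> \<Longrightarrow> i < \<nu> u \<Longrightarrow> u @ [i] \<in> gw_tree \<nu>"

text \<open>
  \<open>N u \<omega>\<close> is the number of offspring of the individual \<open>u\<close>. Each generation is finite, so \<open>card\<close>
  is its true size.
\<close>
definition gw_size :: "(nat list \<Rightarrow> 'a \<Rightarrow> nat) \<Rightarrow> nat \<Rightarrow> 'a \<Rightarrow> nat" where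
  "gw_size N n \<omega> = card {u \<in> gw_tree (\<lambda>v. N v \<omega>). length u = n}"

definition galton_watson ::
    "'a measure \<Rightarrow> nat pmf \<Rightarrow> (nat list \<Rightarrow> 'a \<Rightarrow> nat) \<Rightarrow> bool" where
  "galton_watson M p N \<longleftrightarrow>
     prob_space M \<and>
     prob_space.indep_vars M (\<lambda>_. count_space UNIV) N UNIV \<and>
     (\<forall>u. distr M (count_space UNIV) (N u) = measure_pmf p)"

definition offspring_mean :: "nat pmf \<Rightarrow> real" where
  "offspring_mean p = measure_pmf.expectation p real"

definition min_offspring :: "nat pmf \<Rightarrow> nat" where
  "min_offspring p = (LEAST n. pmf p n > 0)"

text \<open>Unspecified where the sequence diverges, which is a null set if the offspring mean is finite and positive.\<close>
definition gw_limit :: "nat pmf \<Rightarrow> (nat list \<Rightarrow> 'a \<Rightarrow> nat) \<Rightarrow> 'a \<Rightarrow> real" where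
  "gw_limit p N \<omega> = lim (\<lambda>n. real (gw_size N n \<omega>) / offspring_mean p ^ n)"

text \<open>
  The value is an unspecified natural number where no generation exceeds its minimal size; for a
  nondegenerate offspring law without mass at 0 this is a null set.
\<close>
definition gw_first_excess :: "nat pmf \<Rightarrow> (nat list \<Rightarrow> 'a \<Rightarrow> nat) \<Rightarrow> 'a \<Rightarrow> nat" where
  "gw_first_excess p N \<omega> = (LEAST k. gw_size N k \<omega> > min_offspring p ^ k)"

definition gw_gamma :: "nat pmf \<Rightarrow> real \<Rightarrow> real" where
  "gw_gamma p \<epsilon> = ln (1 / \<epsilon>) / ln (offspring_mean p)"

end

theory Submission
  imports Defs
begin

text \<open>
  Truncating the offspring of generation \<open>n\<close> at \<open>a powr (n / 2)\<close> shows that the increments of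
  \<open>Z n / a ^ n\<close> are summable in mean when \<open>N log N\<close> is integrable, so \<open>W\<close> exists and has
  mean 1. With \<open>q = P(N = 1)\<close>, splitting at the first generation gives, for \<open>F x = P(W < x)\<close>,
  \<open>q * F (a * x) \<le> F x \<le> q * F (a * x) + (1 - q) * (F (a * x))\<^sup>2\<close>. The same recursion at \<open>0\<close> yields
  \<open>W > 0\<close> almost surely, and iterating it gives \<open>F \<epsilon>\<close> of exact order \<open>q powr \<gamma> \<epsilon>\<close>. Moreover
  \<open>P(K = Suc k, W < \<epsilon>) = q ^ k * P(K = 1, W < a ^ k * \<epsilon>)\<close>, and the last factor is at most 1 and at most
  \<open>(F (a ^ Suc k * \<epsilon>))\<^sup>2\<close>, because two subtrees must be small. Hence \<open>P(K = k, W < \<epsilon>)\<close> is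
  at most of order \<open>q powr (\<gamma> \<epsilon> + \<bar>k - \<gamma> \<epsilon>\<bar>)\<close>, which gives exponential decay up to a constant
  factor. The constant is absorbed into the exponent because \<open>K = \<lceil>\<gamma> \<epsilon>\<rceil>\<close> has
  conditional probability bounded away from 0.
\<close>

section \<open>Galton--Watson trees as grafted forests\<close>

text \<open>Everything before the theorem lives on the canonical space \<open>tree_law p\<close> of
  families of offspring numbers indexed by words. There a tree is a root number together with an
  independent forest of copies, so each recursion in law is a single integral over that pair. The
  given probability space enters only at the end, because K and W are functions of the whole family.
  Numerator and denominator of the conditional probability are both small, so rates that agree only
  up to subexponential factors would leave a quotient that is not bounded uniformly in \<epsilon>.
  Upper and lower bounds must match up to constants; this is why the quadratic term of the recursion
  has to be absorbed and cannot be estimated crudely. Thresholds are written as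
  \<open>a powr (- y)\<close>, where \<open>y\<close> is the value of \<gamma>. A second obstacle is
  that the claim has no constant in front of the exponential and starts at x = 1, which calls for a
  gap below 1 as well as a decay rate. The resulting bound holds for each \<epsilon> in (0,1), which
  is stronger than the limsup.\<close>

lemma gw_tree_not_Nil:
  "i # u \<in> gw_tree \<nu> \<longleftrightarrow> i < \<nu> [] \<and> u \<in> gw_tree (\<lambda>v. \<nu> (i # v))"
proof
  \<comment> \<open>Trees grow by appending a letter on the right, whereas the recursion removes the
    first letter. The induction follows the appended letter and keeps the first one fixed.\<close>
  have "w \<in> gw_tree \<nu> \<Longrightarrow> \<forall>i u. w = i # u \<longrightarrow> i < \<nu> [] \<and> u \<in> gw_tree (\<lambda>v. \<nu> (i # v))" for w
  proof (induction rule: gw_tree.induct)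
    case (child w j)
    then show ?case
      by (cases w rule: list.exhaust) (auto intro: gw_tree.intros)
  qed auto
  then show "i # u \<in> gw_tree \<nu> \<Longrightarrow> i < \<nu> [] \<and> u \<in> gw_tree (\<lambda>v. \<nu> (i # v))"
    by blast
  have "u \<in> gw_tree (\<lambda>v. \<nu> (i # v)) \<Longrightarrow> i < \<nu> [] \<Longrightarrow> i # u \<in> gw_tree \<nu>"
  proof (induction rule: gw_tree.induct)
    case root
    then show ?case
      using gw_tree.child[OF gw_tree.root, of i \<nu>] by simp
  next
    case (child u j)
    then show ?case
      using gw_tree.child[of "i # u" \<nu> j] by simp
  qed
  then show "i < \<nu> [] \<and> u \<in> gw_tree (\<lambda>v. \<nu> (i # v)) \<Longrightarrow> i # u \<in> gw_tree \<nu>"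
    by blast
qed

abbreviation generation :: "nat \<Rightarrow> (nat list \<Rightarrow> nat) \<Rightarrow> nat" where
  "generation \<equiv> gw_size (\<lambda>u \<nu>. \<nu> u)"

lemma generation_0 [simp]: "generation 0 \<nu> = 1"
proof -
  have "{u \<in> gw_tree \<nu>. length u = 0} = {[]}"
    by (auto intro: gw_tree.intros)
  then show ?thesis
    by (simp add: gw_size_def)
qed

lemma generation_level_Suc:
  "{u \<in> gw_tree \<nu>. length u = Suc n} =
    (\<Union>i<\<nu> []. Cons i ` {u \<in> gw_tree (\<lambda>v. \<nu> (i # v)). length u = n})"
proof (intro set_eqI)
  fix u
  show "u \<in> {u \<in> gw_tree \<nu>. length u = Suc n} \<longleftrightarrow>
    u \<in> (\<Union>i<\<nu> []. Cons i ` {u \<in> gw_tree (\<lambda>v. \<nu> (i # v)). length u = n})"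
    by (cases u) (auto simp: gw_tree_not_Nil)
qed

lemma finite_generation_level: "finite {u \<in> gw_tree \<nu>. length u = n}"
proof (induction n arbitrary: \<nu>)
  case 0
  have "{u \<in> gw_tree \<nu>. length u = 0} \<subseteq> {[]}"
    by auto
  then show ?case
    using finite_subset by blast
next
  case (Suc n)
  then show ?case
    unfolding generation_level_Suc by auto
qed

lemma generation_Suc:
  "generation (Suc n) \<nu> = (\<Sum>i<\<nu> []. generation n (\<lambda>v. \<nu> (i # v)))"
proof -
  have "generation (Suc n) \<nu> =
    card (\<Union>i<\<nu> []. Cons i ` {u \<in> gw_tree (\<lambda>v. \<nu> (i # v)). length u = n})"
    unfolding gw_size_def generation_level_Suc ..
  also have "\<dots> = (\<Sum>i<\<nu> []. card (Cons i ` {u \<in> gw_tree (\<lambda>v. \<nu> (i # v)). length u = n}))"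
    by (rule card_UN_disjoint) (auto simp: finite_generation_level)
  also have "\<dots> = (\<Sum>i<\<nu> []. generation n (\<lambda>v. \<nu> (i # v)))"
    unfolding gw_size_def by (intro sum.cong card_image refl) auto
  finally show ?thesis .
qed

text \<open>Sums \<open>g (\<nu> u)\<close> over the individuals \<open>u\<close> of generation \<open>n\<close>, decomposed at the first generation
  so that moments can be computed by induction on \<open>n\<close>.\<close>

primrec generation_sum :: "(nat \<Rightarrow> real) \<Rightarrow> nat \<Rightarrow> (nat list \<Rightarrow> nat) \<Rightarrow> real" where
  "generation_sum g 0 \<nu> = g (\<nu> [])"
| "generation_sum g (Suc n) \<nu> = (\<Sum>i<\<nu> []. generation_sum g n (\<lambda>v. \<nu> (i # v)))"

lemma generation_sum_const: "generation_sum (\<lambda>_. c) n \<nu> = c * real (generation n \<nu>)"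
  by (induction n arbitrary: \<nu>) (simp_all add: generation_Suc sum_distrib_left)

lemma generation_sum_real: "generation_sum real n \<nu> = real (generation (Suc n) \<nu>)"
  by (induction n arbitrary: \<nu>) (simp_all add: generation_Suc)

lemma generation_sum_add:
  "generation_sum (\<lambda>k. g k + h k) n \<nu> = generation_sum g n \<nu> + generation_sum h n \<nu>"
  by (induction n arbitrary: \<nu>) (simp_all add: sum.distrib)

section \<open>Product laws of trees and forests, and the branching property\<close>

abbreviation tree_law :: "nat pmf \<Rightarrow> (nat list \<Rightarrow> nat) measure" where
  "tree_law p \<equiv> Pi\<^sub>M UNIV (\<lambda>_. measure_pmf p)"

abbreviation forest_law :: "nat pmf \<Rightarrow> (nat \<Rightarrow> nat list \<Rightarrow> nat) measure" where
  "forest_law p \<equiv> Pi\<^sub>M UNIV (\<lambda>_. tree_law p)"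

text \<open>The forest is indexed by all naturals although the tree reaches only the entries below
  \<open>m\<close>. In this way the forest has one law for all \<open>m\<close> and can be
  independent of the root number.\<close>

fun graft :: "nat \<Rightarrow> (nat \<Rightarrow> nat list \<Rightarrow> nat) \<Rightarrow> nat list \<Rightarrow> nat" where
  "graft m s [] = m"
| "graft m s (i # v) = s i v"

lemma generation_Suc_graft: "generation (Suc n) (graft m s) = (\<Sum>i<m. generation n (s i))"
  by (simp add: generation_Suc)

lemma generation_sum_Suc_graft:
  "generation_sum g (Suc n) (graft m s) = (\<Sum>i<m. generation_sum g n (s i))"
  by simp

lemma prob_space_tree_law: "prob_space (tree_law p)"
  by (intro prob_space_PiM measure_pmf.prob_space_axioms)

lemma prob_space_forest_law: "prob_space (forest_law p)"
  by (intro prob_space_PiM prob_space_tree_law)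

lemma space_tree_law [simp]: "space (tree_law p) = UNIV"
  by (auto simp: space_PiM)

lemma space_forest_law [simp]: "space (forest_law p) = UNIV"
  by (auto simp: space_PiM)

lemma measurable_tree_component [measurable]:
  "(\<lambda>\<nu>. \<nu> u) \<in> measurable (tree_law p) (count_space UNIV)"
proof -
  have "(\<lambda>\<nu>. \<nu> u) \<in> measurable (tree_law p) (measure_pmf p)"
    by (rule measurable_component_singleton) simp
  then show ?thesis
    by (simp cong: measurable_cong_sets)
qed

lemma measurable_tree_lawI:
  assumes "\<And>u. (\<lambda>x. f x u) \<in> measurable M (count_space UNIV)"
  shows "f \<in> measurable M (tree_law p)"
proof (rule measurable_PiM_single')
  show "(\<lambda>x. f x u) \<in> measurable M (measure_pmf p)" for u
    using assms[of u] by (simp cong: measurable_cong_sets)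
qed auto

lemma measurable_subtree:
  "(\<lambda>\<nu> v. \<nu> (i # v)) \<in> measurable (tree_law p) (tree_law p)"
  by (rule measurable_tree_lawI) simp

lemma measurable_graft:
  "(\<lambda>(m, s). graft m s) \<in> measurable (measure_pmf p \<Otimes>\<^sub>M forest_law p) (tree_law p)"
proof (rule measurable_tree_lawI)
  fix u
  show "(\<lambda>x. (case x of (m, s) \<Rightarrow> graft m s) u)
    \<in> measurable (measure_pmf p \<Otimes>\<^sub>M forest_law p) (count_space UNIV)"
  proof (cases u)
    case Nil
    have "fst \<in> measurable (measure_pmf p \<Otimes>\<^sub>M forest_law p) (measure_pmf p)"
      by (rule measurable_fst)
    then show ?thesis
      using Nil by (simp add: case_prod_beta cong: measurable_cong_sets)
  next
    case (Cons i v)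
    have "(\<lambda>x. snd x i) \<in> measurable (measure_pmf p \<Otimes>\<^sub>M forest_law p) (tree_law p)"
      by measurable
    then have "(\<lambda>x. snd x i v) \<in> measurable (measure_pmf p \<Otimes>\<^sub>M forest_law p) (count_space UNIV)"
      by (rule measurable_compose) simp
    then show ?thesis
      using Cons by (simp add: case_prod_beta)
  qed
qed

text \<open>This is the branching property. Cylinders determine the law, and the coordinates in
  \<open>J\<close> split into the root and, for each first letter \<open>i\<close> in
  \<open>I\<close>, the words \<open>L i\<close> that remain after removing it. A cylinder therefore
  pulls back to a rectangle, and its mass factors along the same splitting.\<close>

lemma distr_graft:
  "distr (measure_pmf p \<Otimes>\<^sub>M forest_law p) (tree_law p) (\<lambda>(m, s). graft m s) = tree_law p"
proof (rule measure_eqI_PiM_infinite[symmetric, OF refl])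
  interpret P: product_prob_space "\<lambda>_::nat list. measure_pmf p" UNIV
    by (intro product_prob_spaceI measure_pmf.prob_space_axioms)
  interpret S: product_prob_space "\<lambda>_::nat. tree_law p" UNIV
    by (intro product_prob_spaceI prob_space_tree_law)
  show "finite_measure (tree_law p)"
    by unfold_locales
  fix A :: "nat list \<Rightarrow> nat set" and J :: "nat list set"
  assume J: "finite J" "J \<subseteq> UNIV"
  define I where "I = hd ` (J - {[]})"
  define L where "L i = {v. i # v \<in> J}" for i
  define C where "C i = {w. \<forall>v\<in>L i. w v \<in> A (i # v)}" for i
  define A0 where "A0 = (if [] \<in> J then A [] else UNIV)"
  have finI: "finite I"
    using J by (simp add: I_def)
  have finL: "finite (L i)" for i
    unfolding L_def by (rule finite_subset[of _ "tl ` J"]) (use J in \<open>auto intro!: image_eqI\<close>)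
  have eJ: "J - {[]} = (\<lambda>(i, v). i # v) ` Sigma I L"
  proof (intro set_eqI)
    fix u
    show "u \<in> J - {[]} \<longleftrightarrow> u \<in> (\<lambda>(i, v). i # v) ` Sigma I L"
      by (cases u) (force simp: I_def L_def image_iff)+
  qed
  have C_sets: "C i \<in> sets (tree_law p)" for i
  proof -
    have "{w \<in> space (tree_law p). \<forall>v\<in>L i. w v \<in> A (i # v)} \<in> sets (tree_law p)"
    proof (intro sets.sets_Collect_finite_All finL)
      fix v
      show "{w \<in> space (tree_law p). w v \<in> A (i # v)} \<in> sets (tree_law p)"
        using measurable_sets[OF measurable_tree_component[of v p], of "A (i # v)"]
        by (simp add: vimage_def)
    qed
    then show ?thesis
      by (simp add: C_def)
  qed
  have C: "emeasure (tree_law p) (C i) = (\<Prod>v\<in>L i. emeasure (measure_pmf p) (A (i # v)))" for i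
    using P.emeasure_PiM_Collect[of "L i" "\<lambda>v. A (i # v)"] finL[of i]
    by (auto simp: C_def space_PiM)
  have D_sets: "{s. \<forall>i\<in>I. s i \<in> C i} \<in> sets (forest_law p)"
  proof -
    have "{s \<in> space (forest_law p). \<forall>i\<in>I. s i \<in> C i} \<in> sets (forest_law p)"
    proof (intro sets.sets_Collect_finite_All finI)
      fix i
      show "{s \<in> space (forest_law p). s i \<in> C i} \<in> sets (forest_law p)"
        using measurable_sets[OF measurable_component_singleton[of i UNIV "\<lambda>_. tree_law p"], of "C i"] C_sets
        by (simp add: vimage_def)
    qed
    then show ?thesis
      by simp
  qed
  have D: "emeasure (forest_law p) {s. \<forall>i\<in>I. s i \<in> C i} = (\<Prod>i\<in>I. emeasure (tree_law p) (C i))"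
    using S.emeasure_PiM_Collect[of I C] finI C_sets by (auto simp: space_PiM)
  have vim: "(\<lambda>(m, s). graft m s) -` (prod_emb UNIV (\<lambda>_. measure_pmf p) J (Pi\<^sub>E J A)) =
    A0 \<times> {s. \<forall>i\<in>I. s i \<in> C i}"
  proof (intro set_eqI)
    fix x :: "nat \<times> (nat \<Rightarrow> nat list \<Rightarrow> nat)"
    obtain m s where x: "x = (m, s)"
      by (cases x)
    have "(\<forall>u\<in>J. graft m s u \<in> A u) \<longleftrightarrow> m \<in> A0 \<and> (\<forall>u\<in>J - {[]}. graft m s u \<in> A u)"
      by (auto simp: A0_def)
    also have "\<dots> \<longleftrightarrow> m \<in> A0 \<and> (\<forall>i\<in>I. s i \<in> C i)"
      unfolding eJ by (auto simp: C_def)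
    finally show "x \<in> (\<lambda>(m, s). graft m s) -` (prod_emb UNIV (\<lambda>_. measure_pmf p) J (Pi\<^sub>E J A)) \<longleftrightarrow>
        x \<in> A0 \<times> {s. \<forall>i\<in>I. s i \<in> C i}"
      by (auto simp: x prod_emb_def PiE_iff)
  qed
  have "emeasure (distr (measure_pmf p \<Otimes>\<^sub>M forest_law p) (tree_law p) (\<lambda>(m, s). graft m s))
      (prod_emb UNIV (\<lambda>_. measure_pmf p) J (Pi\<^sub>E J A)) =
    emeasure (measure_pmf p \<Otimes>\<^sub>M forest_law p) (A0 \<times> {s. \<forall>i\<in>I. s i \<in> C i})"
    using J by (subst emeasure_distr[OF measurable_graft])
      (auto simp: vim space_pair_measure intro!: sets_PiM_I)
  also have "\<dots> = emeasure (measure_pmf p) A0 * (\<Prod>i\<in>I. \<Prod>v\<in>L i. emeasure (measure_pmf p) (A (i # v)))"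
    using D_sets D by (subst S.emeasure_pair_measure_Times) (simp_all add: C)
  also have "(\<Prod>i\<in>I. \<Prod>v\<in>L i. emeasure (measure_pmf p) (A (i # v))) =
      (\<Prod>u\<in>J - {[]}. emeasure (measure_pmf p) (A u))"
    unfolding eJ using finI finL
    by (subst prod.reindex) (auto simp: inj_on_def prod.Sigma case_prod_beta)
  also have "emeasure (measure_pmf p) A0 * \<dots> = (\<Prod>u\<in>J. emeasure (measure_pmf p) (A u))"
    using J by (auto simp: A0_def prod.remove[of J "[]"])
  also have "\<dots> = emeasure (tree_law p) (prod_emb UNIV (\<lambda>_. measure_pmf p) J (Pi\<^sub>E J A))"
    using J by (subst P.emeasure_PiM_emb) auto
  finally show "emeasure (tree_law p) (prod_emb UNIV (\<lambda>_. measure_pmf p) J (Pi\<^sub>E J A)) =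
    emeasure (distr (measure_pmf p \<Otimes>\<^sub>M forest_law p) (tree_law p) (\<lambda>(m, s). graft m s))
      (prod_emb UNIV (\<lambda>_. measure_pmf p) J (Pi\<^sub>E J A))"
    by simp
qed simp

section \<open>Moments of generation sums\<close>

lemma nn_integral_tree_law:
  assumes f [measurable]: "f \<in> borel_measurable (tree_law p)"
  shows "(\<integral>\<^sup>+\<nu>. f \<nu> \<partial>tree_law p) = (\<integral>\<^sup>+m. \<integral>\<^sup>+s. f (graft m s) \<partial>forest_law p \<partial>measure_pmf p)"
proof -
  interpret F: prob_space "forest_law p"
    by (rule prob_space_forest_law)
  note measurable_graft [measurable]
  have "(\<integral>\<^sup>+\<nu>. f \<nu> \<partial>tree_law p) =
      (\<integral>\<^sup>+x. f (case x of (m, s) \<Rightarrow> graft m s) \<partial>(measure_pmf p \<Otimes>\<^sub>M forest_law p))"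
    by (subst distr_graft[symmetric], subst nn_integral_distr) auto
  also have "\<dots> = (\<integral>\<^sup>+m. \<integral>\<^sup>+s. f (graft m s) \<partial>forest_law p \<partial>measure_pmf p)"
    by (subst F.nn_integral_fst[symmetric]) auto
  finally show ?thesis .
qed

lemma integral_tree_law:
  fixes f :: "_ \<Rightarrow> real"
  assumes f: "integrable (tree_law p) f"
  shows "(\<integral>\<nu>. f \<nu> \<partial>tree_law p) = (\<integral>m. \<integral>s. f (graft m s) \<partial>forest_law p \<partial>measure_pmf p)"
proof -
  interpret F: prob_space "forest_law p"
    by (rule prob_space_forest_law)
  interpret PF: pair_sigma_finite "measure_pmf p" "forest_law p" ..
  note measurable_graft [measurable]
  have [measurable]: "f \<in> borel_measurable (tree_law p)"
    using f by auto
  have int: "integrable (measure_pmf p \<Otimes>\<^sub>M forest_law p) (\<lambda>x. f (case x of (m, s) \<Rightarrow> graft m s))"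
    using f by (subst (asm) distr_graft[symmetric], subst (asm) integrable_distr_eq) auto
  have "(\<integral>\<nu>. f \<nu> \<partial>tree_law p) =
      (\<integral>x. f (case x of (m, s) \<Rightarrow> graft m s) \<partial>(measure_pmf p \<Otimes>\<^sub>M forest_law p))"
    by (subst distr_graft[symmetric], subst integral_distr) auto
  also have "\<dots> = (\<integral>m. \<integral>s. f (graft m s) \<partial>forest_law p \<partial>measure_pmf p)"
    using PF.integral_fst'[OF int] by simp
  finally show ?thesis .
qed

lemma distr_forest_component: "distr (forest_law p) (tree_law p) (\<lambda>s. s i) = tree_law p"
  by (rule distr_PiM_component) (auto intro: prob_space_tree_law)

lemma nn_integral_forest_component:
  assumes [measurable]: "f \<in> borel_measurable (tree_law p)"
  shows "(\<integral>\<^sup>+s. f (s i) \<partial>forest_law p) = (\<integral>\<^sup>+\<nu>. f \<nu> \<partial>tree_law p)"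
  using nn_integral_distr[of "\<lambda>s. s i" "forest_law p" "tree_law p" f]
  by (simp add: distr_forest_component)

lemma integral_forest_component:
  fixes f :: "_ \<Rightarrow> real"
  assumes [measurable]: "f \<in> borel_measurable (tree_law p)"
  shows "(\<integral>s. f (s i) \<partial>forest_law p) = (\<integral>\<nu>. f \<nu> \<partial>tree_law p)"
  using integral_distr[of "\<lambda>s. s i" "forest_law p" "tree_law p" f]
  by (simp add: distr_forest_component)

lemma integrable_forest_component:
  fixes f :: "_ \<Rightarrow> real"
  assumes f: "integrable (tree_law p) f"
  shows "integrable (forest_law p) (\<lambda>s. f (s i))"
proof -
  have "f \<in> borel_measurable (tree_law p)"
    using f by auto
  then show ?thesis
    using integrable_distr_eq[of "\<lambda>s. s i" "forest_law p" "tree_law p" f] f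
    by (simp add: distr_forest_component)
qed

lemma AE_forest_component:
  assumes "AE \<nu> in tree_law p. P \<nu>"
  shows "AE s in forest_law p. P (s i)"
  by (rule AE_PiM_component) (use assms in \<open>auto intro: prob_space_tree_law\<close>)

lemma emeasure_forest_inter:
  assumes "finite I" "A \<in> sets (tree_law p)"
  shows "emeasure (forest_law p) {s. \<forall>i\<in>I. s i \<in> A} = emeasure (tree_law p) A ^ card I"
proof -
  interpret S: product_prob_space "\<lambda>_::nat. tree_law p" UNIV
    by (intro product_prob_spaceI prob_space_tree_law)
  show ?thesis
    using S.emeasure_PiM_Collect[of I "\<lambda>_. A"] assms by simp
qed

lemma indep_vars_forest_components:
  "prob_space.indep_vars (forest_law p) (\<lambda>_. tree_law p) (\<lambda>i s. s i) UNIV"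
proof -
  interpret F: prob_space "forest_law p"
    by (rule prob_space_forest_law)
  have restrict: "(\<lambda>x. restrict x UNIV) = (\<lambda>x. x)"
    by (simp add: restrict_def)
  show ?thesis
    by (subst F.indep_vars_iff_distr_eq_PiM) (auto simp: distr_forest_component restrict)
qed

lemma integral_forest_product:
  fixes f :: "_ \<Rightarrow> real"
  assumes f: "integrable (tree_law p) f" and "i \<noteq> j"
  shows "integrable (forest_law p) (\<lambda>s. f (s i) * f (s j))"
    and "(\<integral>s. f (s i) * f (s j) \<partial>forest_law p) = (\<integral>\<nu>. f \<nu> \<partial>tree_law p) * (\<integral>\<nu>. f \<nu> \<partial>tree_law p)"
proof -
  interpret F: prob_space "forest_law p"
    by (rule prob_space_forest_law)
  have [measurable]: "f \<in> borel_measurable (tree_law p)"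
    using f by auto
  have "F.indep_vars (\<lambda>_. borel) (\<lambda>i s. f (s i)) UNIV"
    by (rule F.indep_vars_compose2[OF indep_vars_forest_components]) simp
  then have ind: "F.indep_vars (\<lambda>_. borel) (\<lambda>i s. f (s i)) {i, j}"
    by (rule F.indep_vars_subset) auto
  have int: "integrable (forest_law p) (\<lambda>s. f (s k))" for k
    by (rule integrable_forest_component[OF f])
  show "integrable (forest_law p) (\<lambda>s. f (s i) * f (s j))"
    using F.indep_vars_integrable[OF _ ind int] \<open>i \<noteq> j\<close> by simp
  show "(\<integral>s. f (s i) * f (s j) \<partial>forest_law p) = (\<integral>\<nu>. f \<nu> \<partial>tree_law p) * (\<integral>\<nu>. f \<nu> \<partial>tree_law p)"
    using F.indep_vars_lebesgue_integral[OF _ ind int] \<open>i \<noteq> j\<close>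
    by (simp add: integral_forest_component)
qed

text \<open>Distinct subtrees are independent and \<open>f\<close> is centred, so the cross terms
  vanish and only the diagonal remains.\<close>

lemma nn_integral_square_forest_sum:
  fixes f :: "_ \<Rightarrow> real"
  assumes f: "integrable (tree_law p) f" "integrable (tree_law p) (\<lambda>\<nu>. (f \<nu>)\<^sup>2)"
    and "(\<integral>\<nu>. f \<nu> \<partial>tree_law p) = 0"
  shows "(\<integral>\<^sup>+s. ennreal ((\<Sum>i<m. f (s i))\<^sup>2) \<partial>forest_law p) =
    ennreal (real m) * (\<integral>\<^sup>+\<nu>. ennreal ((f \<nu>)\<^sup>2) \<partial>tree_law p)"
proof -
  have [measurable]: "f \<in> borel_measurable (tree_law p)"
    using f by auto
  have prod: "integrable (forest_law p) (\<lambda>s. f (s i) * f (s j))" for i j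
    using integral_forest_product(1)[OF f(1), of i j] integrable_forest_component[OF f(2), of i]
    by (cases "i = j") (auto simp: power2_eq_square)
  have expand: "(\<Sum>i<m. f (s i))\<^sup>2 = (\<Sum>i<m. \<Sum>j<m. f (s i) * f (s j))" for s
    by (simp add: power2_eq_square sum_product)
  have "(\<integral>s. (\<Sum>i<m. f (s i))\<^sup>2 \<partial>forest_law p) =
      (\<Sum>i<m. \<Sum>j<m. (\<integral>s. f (s i) * f (s j) \<partial>forest_law p))"
    unfolding expand using prod by (simp add: Bochner_Integration.integral_sum)
  also have "\<dots> = (\<Sum>i<m. \<Sum>j<m. if i = j then (\<integral>\<nu>. (f \<nu>)\<^sup>2 \<partial>tree_law p) else 0)"
    using integral_forest_product(2)[OF f(1)] assms(3)
      integral_forest_component[of "\<lambda>\<nu>. (f \<nu>)\<^sup>2"]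
    by (intro sum.cong refl) (auto simp: power2_eq_square)
  also have "\<dots> = real m * (\<integral>\<nu>. (f \<nu>)\<^sup>2 \<partial>tree_law p)"
    by simp
  finally have eq: "(\<integral>s. (\<Sum>i<m. f (s i))\<^sup>2 \<partial>forest_law p) = real m * (\<integral>\<nu>. (f \<nu>)\<^sup>2 \<partial>tree_law p)" .
  have "integrable (forest_law p) (\<lambda>s. (\<Sum>i<m. f (s i))\<^sup>2)"
    unfolding expand using prod by auto
  then have "(\<integral>\<^sup>+s. ennreal ((\<Sum>i<m. f (s i))\<^sup>2) \<partial>forest_law p) =
      ennreal (real m * (\<integral>\<nu>. (f \<nu>)\<^sup>2 \<partial>tree_law p))"
    by (subst nn_integral_eq_integral) (auto simp: eq)
  also have "\<dots> = ennreal (real m) * (\<integral>\<^sup>+\<nu>. ennreal ((f \<nu>)\<^sup>2) \<partial>tree_law p)"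
    using f(2) by (subst nn_integral_eq_integral) (auto simp: ennreal_mult)
  finally show ?thesis .
qed

lemma measurable_generation_sum [measurable]:
  "generation_sum g n \<in> borel_measurable (tree_law p)"
proof (induction n)
  case 0
  show ?case
    by (simp add: measurable_compose[OF measurable_tree_component])
next
  case (Suc n)
  note Suc [measurable]
  have "(\<lambda>\<nu>. \<Sum>i<\<nu> []. generation_sum g n (\<lambda>v. \<nu> (i # v))) \<in> borel_measurable (tree_law p)"
  \<comment> \<open>The number of summands depends on the tree, but takes countably many values; for
    each fixed value the sum is measurable.\<close>
  proof (rule measurable_compose_countable[where f = "\<lambda>m \<nu>. \<Sum>i<m. generation_sum g n (\<lambda>v. \<nu> (i # v))",
        OF _ measurable_tree_component])
    fix m :: nat
    show "(\<lambda>\<nu>. \<Sum>i<m. generation_sum g n (\<lambda>v. \<nu> (i # v))) \<in> borel_measurable (tree_law p)"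
      by (intro borel_measurable_sum measurable_compose[OF measurable_subtree Suc])
  qed
  moreover have "generation_sum g (Suc n) = (\<lambda>\<nu>. \<Sum>i<\<nu> []. generation_sum g n (\<lambda>v. \<nu> (i # v)))"
    by (simp add: fun_eq_iff)
  ultimately show ?case
    by (simp only:)
qed

lemma measurable_generation [measurable]:
  "generation n \<in> measurable (tree_law p) (count_space UNIV)"
proof -
  \<comment> \<open>The generation size is the generation sum of the constant 1, read back as a
    natural number through the floor.\<close>
  have "(\<lambda>\<nu>. nat \<lfloor>generation_sum (\<lambda>_. 1) n \<nu>\<rfloor>) \<in> measurable (tree_law p) (count_space UNIV)"
    by (rule measurable_compose[OF measurable_generation_sum]) measurable
  then show ?thesis
    by (simp add: generation_sum_const)
qed

context
  fixes p :: "nat pmf"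
  assumes int_p: "integrable (measure_pmf p) real"
begin

lemma nn_integral_offspring: "(\<integral>\<^sup>+m. ennreal (real m) \<partial>measure_pmf p) = ennreal (offspring_mean p)"
  using int_p unfolding offspring_mean_def by (intro nn_integral_eq_integral) auto

lemma offspring_mean_nonneg: "offspring_mean p \<ge> 0"
  unfolding offspring_mean_def by simp

text \<open>The triangle inequality at the root turns each generation into one factor
  \<open>offspring_mean p\<close>. Working with nonnegative integrals lets the bound itself deliver
  integrability of generation sums.\<close>

lemma nn_integral_abs_generation_sum:
  "(\<integral>\<^sup>+\<nu>. ennreal \<bar>generation_sum g n \<nu>\<bar> \<partial>tree_law p) \<le>
    ennreal (offspring_mean p ^ n) * (\<integral>\<^sup>+m. ennreal \<bar>g m\<bar> \<partial>measure_pmf p)"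
proof (induction n)
  case 0
  have "distr (tree_law p) (measure_pmf p) (\<lambda>\<nu>. \<nu> []) = measure_pmf p"
    by (rule distr_PiM_component) (auto intro: measure_pmf.prob_space_axioms)
  then have "(\<integral>\<^sup>+m. ennreal \<bar>g m\<bar> \<partial>measure_pmf p) = (\<integral>\<^sup>+\<nu>. ennreal \<bar>g (\<nu> [])\<bar> \<partial>tree_law p)"
    using nn_integral_distr[of "\<lambda>\<nu>. \<nu> []" "tree_law p" "measure_pmf p" "\<lambda>m. ennreal \<bar>g m\<bar>"]
    by simp
  then show ?case
    by simp
next
  case (Suc n)
  let ?I = "\<integral>\<^sup>+\<nu>. ennreal \<bar>generation_sum g n \<nu>\<bar> \<partial>tree_law p"
  have "(\<integral>\<^sup>+\<nu>. ennreal \<bar>generation_sum g (Suc n) \<nu>\<bar> \<partial>tree_law p) =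
      (\<integral>\<^sup>+m. \<integral>\<^sup>+s. ennreal \<bar>\<Sum>i<m. generation_sum g n (s i)\<bar> \<partial>forest_law p \<partial>measure_pmf p)"
    by (subst nn_integral_tree_law) (auto simp del: generation_sum.simps simp: generation_sum_Suc_graft)
  also have "\<dots> \<le> (\<integral>\<^sup>+m. \<integral>\<^sup>+s. (\<Sum>i<m. ennreal \<bar>generation_sum g n (s i)\<bar>) \<partial>forest_law p \<partial>measure_pmf p)"
    by (intro nn_integral_mono) (simp add: sum_ennreal ennreal_leI)
  also have "\<dots> = (\<integral>\<^sup>+m. ennreal (real m) * ?I \<partial>measure_pmf p)"
  proof (rule nn_integral_cong)
    fix m
    have "(\<integral>\<^sup>+s. (\<Sum>i<m. ennreal \<bar>generation_sum g n (s i)\<bar>) \<partial>forest_law p) = (\<Sum>i<m. ?I)"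
      by (subst nn_integral_sum)
        (auto simp: nn_integral_forest_component[of "\<lambda>\<nu>. ennreal \<bar>generation_sum g n \<nu>\<bar>"])
    then show "(\<integral>\<^sup>+s. (\<Sum>i<m. ennreal \<bar>generation_sum g n (s i)\<bar>) \<partial>forest_law p) = ennreal (real m) * ?I"
      by (simp add: ennreal_of_nat_eq_real_of_nat)
  qed
  also have "\<dots> = ennreal (offspring_mean p) * ?I"
    by (simp add: nn_integral_multc nn_integral_offspring)
  also have "\<dots> \<le> ennreal (offspring_mean p) *
      (ennreal (offspring_mean p ^ n) * (\<integral>\<^sup>+m. ennreal \<bar>g m\<bar> \<partial>measure_pmf p))"
    by (intro mult_left_mono Suc) auto
  also have "\<dots> = ennreal (offspring_mean p ^ Suc n) * (\<integral>\<^sup>+m. ennreal \<bar>g m\<bar> \<partial>measure_pmf p)"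
    using offspring_mean_nonneg by (simp add: ennreal_mult mult.assoc)
  finally show ?case .
qed

lemma integrable_generation_sum:
  assumes "integrable (measure_pmf p) g"
  shows "integrable (tree_law p) (generation_sum g n)"
proof (rule integrableI_bounded)
  have "(\<integral>\<^sup>+m. ennreal \<bar>g m\<bar> \<partial>measure_pmf p) < \<infinity>"
    using assms by (simp add: integrable_iff_bounded)
  then have "ennreal (offspring_mean p ^ n) * (\<integral>\<^sup>+m. ennreal \<bar>g m\<bar> \<partial>measure_pmf p) < \<infinity>"
    by (simp add: ennreal_mult_less_top)
  then show "(\<integral>\<^sup>+\<nu>. ennreal (norm (generation_sum g n \<nu>)) \<partial>tree_law p) < \<infinity>"
    using nn_integral_abs_generation_sum[of g n] by (auto intro: le_less_trans)
qed simp

lemma integral_generation_sum: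
  assumes "integrable (measure_pmf p) g"
  shows "(\<integral>\<nu>. generation_sum g n \<nu> \<partial>tree_law p) = offspring_mean p ^ n * (\<integral>m. g m \<partial>measure_pmf p)"
proof (induction n)
  case 0
  have "distr (tree_law p) (measure_pmf p) (\<lambda>\<nu>. \<nu> []) = measure_pmf p"
    by (rule distr_PiM_component) (auto intro: measure_pmf.prob_space_axioms)
  then have "(\<integral>m. g m \<partial>measure_pmf p) = (\<integral>\<nu>. g (\<nu> []) \<partial>tree_law p)"
    using integral_distr[of "\<lambda>\<nu>. \<nu> []" "tree_law p" "measure_pmf p" g]
    by simp
  then show ?case
    by simp
next
  case (Suc n)
  have "(\<integral>\<nu>. generation_sum g (Suc n) \<nu> \<partial>tree_law p) =
      (\<integral>m. \<integral>s. (\<Sum>i<m. generation_sum g n (s i)) \<partial>forest_law p \<partial>measure_pmf p)"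
    by (subst integral_tree_law[OF integrable_generation_sum[OF assms]]) simp
  also have "\<dots> = (\<integral>m. real m * (\<integral>\<nu>. generation_sum g n \<nu> \<partial>tree_law p) \<partial>measure_pmf p)"
    using integrable_forest_component[OF integrable_generation_sum[OF assms]]
    by (simp add: Bochner_Integration.integral_sum integral_forest_component)
  finally show ?case
    using Suc by (simp add: offspring_mean_def)
qed

text \<open>Centring is what pays here: variances add over the individuals, so the second moment
  grows like the mean size of the generation and not like its square.\<close>

lemma nn_integral_square_generation_sum:
  assumes g: "integrable (measure_pmf p) g" "integrable (measure_pmf p) (\<lambda>m. (g m)\<^sup>2)"
    and "(\<integral>m. g m \<partial>measure_pmf p) = 0"
  shows "(\<integral>\<^sup>+\<nu>. ennreal ((generation_sum g n \<nu>)\<^sup>2) \<partial>tree_law p) =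
    ennreal (offspring_mean p ^ n * (\<integral>m. (g m)\<^sup>2 \<partial>measure_pmf p))"
proof (induction n)
  case 0
  have "distr (tree_law p) (measure_pmf p) (\<lambda>\<nu>. \<nu> []) = measure_pmf p"
    by (rule distr_PiM_component) (auto intro: measure_pmf.prob_space_axioms)
  then have "(\<integral>\<^sup>+m. ennreal ((g m)\<^sup>2) \<partial>measure_pmf p) = (\<integral>\<^sup>+\<nu>. ennreal ((g (\<nu> []))\<^sup>2) \<partial>tree_law p)"
    using nn_integral_distr[of "\<lambda>\<nu>. \<nu> []" "tree_law p" "measure_pmf p" "\<lambda>m. ennreal ((g m)\<^sup>2)"]
    by simp
  then show ?case
    using g(2) by (simp add: nn_integral_eq_integral)
next
  case (Suc n)
  let ?I = "offspring_mean p ^ n * (\<integral>m. (g m)\<^sup>2 \<partial>measure_pmf p)"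
  have sq: "integrable (tree_law p) (\<lambda>\<nu>. (generation_sum g n \<nu>)\<^sup>2)"
    using Suc by (intro integrableI_bounded) auto
  have "(\<integral>\<^sup>+\<nu>. ennreal ((generation_sum g (Suc n) \<nu>)\<^sup>2) \<partial>tree_law p) =
      (\<integral>\<^sup>+m. \<integral>\<^sup>+s. ennreal ((\<Sum>i<m. generation_sum g n (s i))\<^sup>2) \<partial>forest_law p \<partial>measure_pmf p)"
    by (subst nn_integral_tree_law) (auto simp del: generation_sum.simps simp: generation_sum_Suc_graft)
  also have "\<dots> = (\<integral>\<^sup>+m. ennreal (real m) * ennreal ?I \<partial>measure_pmf p)"
    using integrable_generation_sum[OF g(1), of n] sq integral_generation_sum[OF g(1), of n] assms(3)
    by (subst nn_integral_square_forest_sum) (auto simp: Suc)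
  also have "\<dots> = ennreal (offspring_mean p) * ennreal ?I"
    by (simp add: nn_integral_multc nn_integral_offspring)
  also have "\<dots> = ennreal (offspring_mean p ^ Suc n * (\<integral>m. (g m)\<^sup>2 \<partial>measure_pmf p))"
    using offspring_mean_nonneg by (simp add: ennreal_mult[symmetric] mult.assoc)
  finally show ?case .
qed

end

lemma emeasure_tree_law:
  assumes [measurable]: "A \<in> sets (tree_law p)"
  shows "emeasure (tree_law p) A = (\<integral>\<^sup>+m. emeasure (forest_law p) {s. graft m s \<in> A} \<partial>measure_pmf p)"
    and "{s. graft m s \<in> A} \<in> sets (forest_law p)"
proof -
  have graft_m: "graft m \<in> measurable (forest_law p) (tree_law p)" for m
    using measurable_compose[OF measurable_Pair1'[of m "measure_pmf p"] measurable_graft[of p]] by simp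
  have sets: "{s. graft m s \<in> A} \<in> sets (forest_law p)" for m
    using measurable_sets[OF graft_m assms] by (simp add: vimage_def)
  then show "{s. graft m s \<in> A} \<in> sets (forest_law p)" .
  have "emeasure (tree_law p) A = (\<integral>\<^sup>+\<nu>. indicator A \<nu> \<partial>tree_law p)"
    by simp
  also have "\<dots> = (\<integral>\<^sup>+m. \<integral>\<^sup>+s. indicator A (graft m s) \<partial>forest_law p \<partial>measure_pmf p)"
    by (rule nn_integral_tree_law) simp
  also have "\<dots> = (\<integral>\<^sup>+m. \<integral>\<^sup>+s. indicator {s. graft m s \<in> A} s \<partial>forest_law p \<partial>measure_pmf p)"
    by (simp add: indicator_def)
  also have "\<dots> = (\<integral>\<^sup>+m. emeasure (forest_law p) {s. graft m s \<in> A} \<partial>measure_pmf p)"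
    using sets by simp
  finally show "emeasure (tree_law p) A = (\<integral>\<^sup>+m. emeasure (forest_law p) {s. graft m s \<in> A} \<partial>measure_pmf p)" .
qed

text \<open>Source of the lower bounds: all root numbers but one are discarded. The value
  \<open>m = 1\<close> prolongs the initial single line, a value from 2 on makes it branch at
  once.\<close>

lemma measure_tree_law_ge:
  assumes "A \<in> sets (tree_law p)"
  shows "pmf p m * measure (forest_law p) {s. graft m s \<in> A} \<le> measure (tree_law p) A"
proof -
  interpret F: prob_space "forest_law p"
    by (rule prob_space_forest_law)
  interpret T: prob_space "tree_law p"
    by (rule prob_space_tree_law)
  have "ennreal (measure (forest_law p) {s. graft m s \<in> A} * pmf p m) =
      (\<integral>\<^sup>+k. emeasure (forest_law p) {s. graft m s \<in> A} * indicator {m} k \<partial>measure_pmf p)"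
    by (simp add: nn_integral_cmult emeasure_pmf_single F.emeasure_eq_measure ennreal_mult)
  also have "\<dots> \<le> (\<integral>\<^sup>+k. emeasure (forest_law p) {s. graft k s \<in> A} \<partial>measure_pmf p)"
    by (intro nn_integral_mono) (auto split: split_indicator)
  also have "\<dots> = ennreal (measure (tree_law p) A)"
    using emeasure_tree_law(1)[OF assms] by (simp add: T.emeasure_eq_measure)
  finally show ?thesis
    by (simp add: mult.commute)
qed

lemma measure_forest_component:
  assumes "A \<in> sets (tree_law p)"
  shows "measure (forest_law p) {s. s i \<in> A} = measure (tree_law p) A"
  using emeasure_forest_inter[of "{i}" A p] assms by (simp add: measure_def)

section \<open>The martingale limit\<close>

text \<open>Without mass at 0, \<open>pmf_1_pos\<close> expresses that the minimal offspring number
  is 1, and \<open>pmf_1_less\<close> that the law is nondegenerate.\<close>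

locale offspring_law =
  fixes p :: "nat pmf"
  assumes pmf_0: "pmf p 0 = 0"
    and pmf_1_pos: "pmf p 1 > 0"
    and pmf_1_less: "pmf p 1 < 1"
    and integrable_n_ln_n: "integrable (measure_pmf p) (\<lambda>n. real n * ln (real n))"
begin

abbreviation "q \<equiv> pmf p 1"

abbreviation "a \<equiv> offspring_mean p"

lemma integrable_offspring: "integrable (measure_pmf p) real"
proof (rule Bochner_Integration.integrable_bound)
  \<comment> \<open>The constant 3 exceeds \<open>exp 1\<close>: it dominates \<open>n\<close> up to
    3, and beyond it \<open>ln n\<close> is at least 1.\<close>
  show "integrable (measure_pmf p) (\<lambda>n. 3 + real n * ln (real n))"
    using integrable_n_ln_n by simp
  have "real n \<le> 3 + real n * ln (real n)" for n
  proof (cases "n \<le> 3")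
    case True
    have "real n * ln (real n) \<ge> 0"
      by (cases "n = 0") auto
    then show ?thesis
      using True by linarith
  next
    case False
    then have "exp 1 \<le> real n"
      using exp_le by linarith
    then have "1 \<le> ln (real n)"
      using False by (subst ln_ge_iff) auto
    then have "real n * 1 \<le> real n * ln (real n)"
      by (intro mult_left_mono) auto
    then show ?thesis
      by simp
  qed
  then show "AE n in measure_pmf p. norm (real n) \<le> norm (3 + real n * ln (real n))"
    by (intro AE_I2) (smt (verit) of_nat_0_le_iff real_norm_def)
qed simp

lemma offspring_pos: "m \<in> set_pmf p \<Longrightarrow> m \<ge> 1"
  using pmf_0 by (cases m) (auto simp: set_pmf_iff)

lemma two_offspring: "\<exists>m\<ge>2. pmf p m > 0"
proof (rule ccontr)
  assume "\<not> ?thesis"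
  then have "m \<in> set_pmf p \<Longrightarrow> m < 2" for m
    by (metis not_le pmf_positive)
  then have "set_pmf p \<subseteq> {1}"
    using offspring_pos by fastforce
  then have "p = return_pmf 1"
    by (simp add: set_pmf_subset_singleton)
  then show False
    using pmf_1_less by simp
qed

lemma offspring_mean_gt_1: "a > 1"
proof -
  have ge: "AE m in measure_pmf p. 0 \<le> real m - 1"
    using offspring_pos by (auto simp: AE_measure_pmf_iff)
  have int: "integrable (measure_pmf p) (\<lambda>m. real m - 1)"
    using integrable_offspring by simp
  have eq: "(\<integral>m. real m - 1 \<partial>measure_pmf p) = a - 1"
    using integrable_offspring by (simp add: offspring_mean_def)
  have "(\<integral>m. real m - 1 \<partial>measure_pmf p) \<noteq> 0"
  proof
    assume "(\<integral>m. real m - 1 \<partial>measure_pmf p) = 0"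
    then have "\<forall>m\<in>set_pmf p. m = 1"
      using integral_nonneg_eq_0_iff_AE[OF int ge] by (auto simp: AE_measure_pmf_iff)
    moreover obtain m where "m \<ge> 2" "m \<in> set_pmf p"
      using two_offspring by (auto simp: set_pmf_iff)
    ultimately show False
      by auto
  qed
  then show ?thesis
    using eq integral_nonneg_AE[OF ge] by linarith
qed

definition normalized :: "nat \<Rightarrow> (nat list \<Rightarrow> nat) \<Rightarrow> real" where
  "normalized n \<nu> = real (generation n \<nu>) / a ^ n"

lemma measurable_normalized [measurable]: "normalized n \<in> borel_measurable (tree_law p)"
  unfolding normalized_def by measurable

definition increment :: "nat \<Rightarrow> (nat list \<Rightarrow> nat) \<Rightarrow> real" where
  "increment n \<nu> = normalized (Suc n) \<nu> - normalized n \<nu>"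

lemma measurable_increment [measurable]: "increment n \<in> borel_measurable (tree_law p)"
  unfolding increment_def by measurable

text \<open>Each individual of generation \<open>n\<close> contributes its offspring number minus
  \<open>a\<close>. The increment is thus a sum of centred terms, to which the moment bounds for
  generation sums apply.\<close>

lemma increment_eq: "increment n \<nu> = generation_sum (\<lambda>k. real k - a) n \<nu> / a ^ Suc n"
proof -
  have "generation_sum (\<lambda>k. real k - a) n \<nu> = real (generation (Suc n) \<nu>) - a * real (generation n \<nu>)"
    using generation_sum_add[of real "\<lambda>_. - a" n \<nu>]
    by (simp add: generation_sum_const generation_sum_real)
  then show ?thesis
    using offspring_mean_gt_1 by (simp add: increment_def normalized_def field_simps)
qed

text \<open>In generation \<open>n\<close> the offspring numbers are truncated at \<open>b ^ (2 * n)\<close>, the square root of \<open>a ^ n\<close>: the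
  second moment bounds the truncated part of the increment by \<open>b ^ (- n)\<close> in mean, and since
  \<open>k\<close> lies in the tail for at most \<open>1 + ln k / (2 * ln b)\<close> values of \<open>n\<close>, the tails are summable.\<close>

definition b :: real where "b = a powr (1 / 4)"

lemma b_gt_1: "b > 1"
  unfolding b_def using offspring_mean_gt_1 by (intro gr_one_powr) auto

lemma b_power_4: "b ^ 4 = a"
  unfolding b_def using offspring_mean_gt_1 by (simp add: powr_realpow[symmetric] powr_powr)

definition tail :: "nat \<Rightarrow> nat \<Rightarrow> real" where
  "tail n k = (if real k > b ^ (2 * n) then real k else 0)"

definition truncated :: "nat \<Rightarrow> nat \<Rightarrow> real" where
  "truncated n k = (if real k > b ^ (2 * n) then 0 else real k)"

lemma tail_nonneg: "tail n k \<ge> 0"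
  by (simp add: tail_def)

lemma truncated_bounds: "0 \<le> truncated n k" "truncated n k \<le> b ^ (2 * n)" "truncated n k \<le> real k"
  using b_gt_1 by (auto simp: truncated_def)

lemma integrable_tail: "integrable (measure_pmf p) (tail n)"
  by (rule Bochner_Integration.integrable_bound[OF integrable_offspring]) (auto simp: tail_def)

lemma integrable_truncated: "integrable (measure_pmf p) (truncated n)"
  by (rule Bochner_Integration.integrable_bound[OF integrable_offspring]) (auto simp: truncated_def)

lemma suminf_tail_le:
  "(\<Sum>n. ennreal (tail n k)) \<le> ennreal (real k + real k * ln (real k) / (2 * ln b))"
proof (cases "k = 0")
  case True
  have "b ^ (2 * n) \<ge> 0" for n
    using b_gt_1 by simp
  then have "tail n k = 0" for n
    using True by (simp add: tail_def)
  then show ?thesis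
    by simp
next
  case False
  \<comment> \<open>\<open>r\<close> solves \<open>b powr (2 * r) = real k\<close>, so from
    \<open>n \<ge> r\<close> on the value \<open>k\<close> lies below the truncation level.\<close>
  define r where "r = ln (real k) / (2 * ln b)"
  have r: "r \<ge> 0"
    using False b_gt_1 by (simp add: r_def)
  have zero: "tail n k = 0" if "n \<ge> nat \<lceil>r\<rceil>" for n
  proof -
    have "r \<le> real n"
      using that by linarith
    then have "ln (real k) \<le> real (2 * n) * ln b"
      using b_gt_1 by (simp add: r_def field_simps)
    also have "\<dots> = ln (b ^ (2 * n))"
      using b_gt_1 by (subst ln_realpow) auto
    finally have "real k \<le> b ^ (2 * n)"
      using False b_gt_1 by (subst (asm) ln_le_cancel_iff) auto
    then show ?thesis
      by (simp add: tail_def)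
  qed
  have "(\<Sum>n. ennreal (tail n k)) = (\<Sum>n<nat \<lceil>r\<rceil>. ennreal (tail n k))"
    using zero by (intro suminf_finite) (auto simp: not_less simp del: nat_ceiling_le_eq)
  also have "\<dots> \<le> (\<Sum>n<nat \<lceil>r\<rceil>. ennreal (real k))"
    by (intro sum_mono ennreal_leI) (simp add: tail_def)
  also have "\<dots> = ennreal (real (nat \<lceil>r\<rceil>) * real k)"
    by (simp add: ennreal_mult ennreal_of_nat_eq_real_of_nat)
  also have "\<dots> \<le> ennreal ((1 + r) * real k)"
    using r by (intro ennreal_leI mult_right_mono) linarith+
  also have "(1 + r) * real k = real k + real k * ln (real k) / (2 * ln b)"
    by (simp add: r_def field_simps)
  finally show ?thesis .
qed

text \<open>After exchanging sum and integral, the number of levels at which \<open>k\<close> counts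
  as large is logarithmic in \<open>k\<close>; integrability of \<open>n * ln n\<close> pays for
  exactly this.\<close>

lemma suminf_nn_integral_tail: "(\<Sum>n. \<integral>\<^sup>+k. ennreal (tail n k) \<partial>measure_pmf p) < \<infinity>"
proof -
  have int: "integrable (measure_pmf p) (\<lambda>k. real k + real k * ln (real k) / (2 * ln b))"
    using integrable_offspring integrable_n_ln_n by simp
  have nn: "real k + real k * ln (real k) / (2 * ln b) \<ge> 0" for k
    using b_gt_1 by (cases "k = 0") auto
  have "(\<Sum>n. \<integral>\<^sup>+k. ennreal (tail n k) \<partial>measure_pmf p) = (\<integral>\<^sup>+k. (\<Sum>n. ennreal (tail n k)) \<partial>measure_pmf p)"
    by (subst nn_integral_suminf) auto
  also have "\<dots> \<le> (\<integral>\<^sup>+k. ennreal (real k + real k * ln (real k) / (2 * ln b)) \<partial>measure_pmf p)"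
    by (intro nn_integral_mono suminf_tail_le)
  also have "\<dots> < \<infinity>"
    using int nn by (subst nn_integral_eq_integral) auto
  finally show ?thesis .
qed

lemma nn_integral_abs_centred_tail:
  "(\<integral>\<^sup>+k. ennreal \<bar>tail n k - (\<integral>k. tail n k \<partial>measure_pmf p)\<bar> \<partial>measure_pmf p) \<le>
    2 * (\<integral>\<^sup>+k. ennreal (tail n k) \<partial>measure_pmf p)"
proof -
  let ?m = "\<integral>k. tail n k \<partial>measure_pmf p"
  have m: "?m \<ge> 0"
    by (intro integral_nonneg_AE) (simp add: tail_nonneg)
  have "(\<integral>\<^sup>+k. ennreal \<bar>tail n k - ?m\<bar> \<partial>measure_pmf p) \<le>
      (\<integral>\<^sup>+k. ennreal (tail n k) + ennreal ?m \<partial>measure_pmf p)"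
  proof (rule nn_integral_mono)
    fix k
    have "\<bar>tail n k - ?m\<bar> \<le> tail n k + ?m"
      using m tail_nonneg[of n k] by linarith
    then show "ennreal \<bar>tail n k - ?m\<bar> \<le> ennreal (tail n k) + ennreal ?m"
      using m tail_nonneg[of n k] by (simp add: ennreal_plus[symmetric] del: ennreal_plus)
  qed
  also have "\<dots> = (\<integral>\<^sup>+k. ennreal (tail n k) \<partial>measure_pmf p) + ennreal ?m"
    by (subst nn_integral_add) auto
  also have "ennreal ?m = (\<integral>\<^sup>+k. ennreal (tail n k) \<partial>measure_pmf p)"
    using integrable_tail by (subst nn_integral_eq_integral) (auto simp: tail_nonneg)
  finally show ?thesis
    by (simp add: mult_2)
qed

text \<open>The variance is at most the second moment. In the square, one factor is bounded by the
  truncation level and the other by \<open>k\<close>, which leaves the mean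
  \<open>a\<close>.\<close>

lemma square_truncated:
  defines "g \<equiv> \<lambda>n k. truncated n k - (\<integral>k. truncated n k \<partial>measure_pmf p)"
  shows "integrable (measure_pmf p) (g n)"
    and "integrable (measure_pmf p) (\<lambda>k. (g n k)\<^sup>2)"
    and "(\<integral>k. g n k \<partial>measure_pmf p) = 0"
    and "(\<integral>k. (g n k)\<^sup>2 \<partial>measure_pmf p) \<le> b ^ (2 * n) * a"
proof -
  let ?m = "\<integral>k. truncated n k \<partial>measure_pmf p"
  note int = integrable_truncated[of n]
  have le: "(truncated n k)\<^sup>2 \<le> b ^ (2 * n) * real k" for k
    unfolding power2_eq_square using truncated_bounds[of n k] by (intro mult_mono) auto
  have int_a: "integrable (measure_pmf p) (\<lambda>k. b ^ (2 * n) * real k)"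
    using integrable_offspring by simp
  have sq: "integrable (measure_pmf p) (\<lambda>k. (truncated n k)\<^sup>2)"
    by (rule Bochner_Integration.integrable_bound[OF int_a]) (use le b_gt_1 in auto)
  show "integrable (measure_pmf p) (g n)"
    unfolding g_def using int by simp
  show "(\<integral>k. g n k \<partial>measure_pmf p) = 0"
    unfolding g_def using int by simp
  have "(g n k)\<^sup>2 = (truncated n k)\<^sup>2 - 2 * ?m * truncated n k + ?m\<^sup>2" for k
    by (simp add: g_def power2_eq_square algebra_simps)
  then show "integrable (measure_pmf p) (\<lambda>k. (g n k)\<^sup>2)"
    using int sq by simp
  have "(\<integral>k. (g n k)\<^sup>2 \<partial>measure_pmf p) = (\<integral>k. (truncated n k)\<^sup>2 \<partial>measure_pmf p) - ?m\<^sup>2"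
    unfolding g_def by (rule measure_pmf.variance_eq[OF int sq])
  also have "\<dots> \<le> (\<integral>k. (truncated n k)\<^sup>2 \<partial>measure_pmf p)"
    by simp
  also have "\<dots> \<le> (\<integral>k. b ^ (2 * n) * real k \<partial>measure_pmf p)"
    by (rule integral_mono[OF sq int_a le])
  also have "\<dots> = b ^ (2 * n) * a"
    by (simp add: offspring_mean_def)
  finally show "(\<integral>k. (g n k)\<^sup>2 \<partial>measure_pmf p) \<le> b ^ (2 * n) * a" .
qed

lemma nn_integral_increment:
  "(\<integral>\<^sup>+\<nu>. ennreal \<bar>increment n \<nu>\<bar> \<partial>tree_law p) \<le>
    2 * (\<integral>\<^sup>+k. ennreal (tail n k) \<partial>measure_pmf p) + ennreal ((1 / b) ^ n)"
proof -
  interpret T: prob_space "tree_law p"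
    by (rule prob_space_tree_law)
  define g1 where "g1 k = truncated n k - (\<integral>k. truncated n k \<partial>measure_pmf p)" for k
  define g2 where "g2 k = tail n k - (\<integral>k. tail n k \<partial>measure_pmf p)" for k
  note g1 = square_truncated[of n, folded g1_def]
  let ?S1 = "generation_sum g1 n" and ?S2 = "generation_sum g2 n"
  \<comment> \<open>The two means add up to \<open>a\<close>, so the pieces can be centred
    separately and still sum to the increment.\<close>
  have "a = (\<integral>k. truncated n k + tail n k \<partial>measure_pmf p)"
    unfolding offspring_mean_def
    by (intro Bochner_Integration.integral_cong) (auto simp: truncated_def tail_def)
  also have "\<dots> = (\<integral>k. truncated n k \<partial>measure_pmf p) + (\<integral>k. tail n k \<partial>measure_pmf p)"
    by (intro Bochner_Integration.integral_add integrable_truncated integrable_tail)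
  finally have "(\<lambda>k. real k - a) = (\<lambda>k. g1 k + g2 k)"
    by (auto simp: fun_eq_iff g1_def g2_def truncated_def tail_def)
  then have inc: "increment n \<nu> = ?S1 \<nu> / a ^ Suc n + ?S2 \<nu> / a ^ Suc n" for \<nu>
    by (simp only: increment_eq generation_sum_add add_divide_distrib)
  have an: "a ^ Suc n > 0" "a ^ n > 0"
    using offspring_mean_gt_1 by simp_all
  have scale: "(\<integral>\<^sup>+\<nu>. ennreal \<bar>generation_sum g n \<nu> / a ^ Suc n\<bar> \<partial>tree_law p) =
      ennreal (1 / a ^ Suc n) * (\<integral>\<^sup>+\<nu>. ennreal \<bar>generation_sum g n \<nu>\<bar> \<partial>tree_law p)" for g
  proof -
    have "ennreal \<bar>generation_sum g n \<nu> / a ^ Suc n\<bar> =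
        ennreal (1 / a ^ Suc n) * ennreal \<bar>generation_sum g n \<nu>\<bar>" for \<nu>
      using an by (subst ennreal_mult[symmetric]) auto
    then show ?thesis
      by (simp add: nn_integral_cmult del: power_Suc)
  qed

  have part2: "(\<integral>\<^sup>+\<nu>. ennreal \<bar>?S2 \<nu> / a ^ Suc n\<bar> \<partial>tree_law p) \<le>
      2 * (\<integral>\<^sup>+k. ennreal (tail n k) \<partial>measure_pmf p)"
  proof -
    have "(\<integral>\<^sup>+\<nu>. ennreal \<bar>?S2 \<nu> / a ^ Suc n\<bar> \<partial>tree_law p) \<le>
        ennreal (1 / a ^ Suc n) * (ennreal (a ^ n) * (2 * (\<integral>\<^sup>+k. ennreal (tail n k) \<partial>measure_pmf p)))"
      unfolding scale
      by (intro mult_left_mono order_trans[OF nn_integral_abs_generation_sum[OF integrable_offspring]])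
        (auto simp: g2_def nn_integral_abs_centred_tail)
    also have "\<dots> = ennreal (1 / a) * (2 * (\<integral>\<^sup>+k. ennreal (tail n k) \<partial>measure_pmf p))"
      using an offspring_mean_gt_1
      by (simp add: mult.assoc[symmetric] ennreal_mult[symmetric])
    also have "\<dots> \<le> 1 * (2 * (\<integral>\<^sup>+k. ennreal (tail n k) \<partial>measure_pmf p))"
      using offspring_mean_gt_1 by (intro mult_right_mono) (auto simp: ennreal_le_1)
    finally show ?thesis
      by simp
  qed

  have part1: "(\<integral>\<^sup>+\<nu>. ennreal \<bar>?S1 \<nu> / a ^ Suc n\<bar> \<partial>tree_law p) \<le> ennreal ((1 / b) ^ n)"
  proof -
    \<comment> \<open>The inequality \<open>\<bar>x\<bar> \<le> c / 2 + x\<^sup>2 / (2 * c)\<close>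
      replaces Cauchy-Schwarz. The second moment is at most \<open>a * b ^ (6 * n)\<close>, so this
      \<open>c\<close> balances both terms up to a constant; dividing by \<open>a ^ Suc n\<close>,
      which is \<open>a * b ^ (4 * n)\<close>, leaves the order \<open>(1 / b) ^ n\<close>.\<close>
    define c where "c = b ^ (3 * n)"
    have c: "c > 0"
      using b_gt_1 by (simp add: c_def)
    have "\<bar>x\<bar> \<le> c / 2 + x\<^sup>2 / (2 * c)" for x
    proof -
      have "0 \<le> (\<bar>x\<bar> - c)\<^sup>2"
        by simp
      also have "\<dots> = x\<^sup>2 + c\<^sup>2 - 2 * c * \<bar>x\<bar>"
        by (simp add: power2_diff)
      finally show ?thesis
        using c by (simp add: field_simps power2_eq_square)
    qed
    then have "ennreal \<bar>x\<bar> \<le> ennreal (c / 2) + ennreal (1 / (2 * c)) * ennreal (x\<^sup>2)" for x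
      using c by (simp add: ennreal_mult[symmetric] ennreal_plus[symmetric] ennreal_leI del: ennreal_plus)
    then have "(\<integral>\<^sup>+\<nu>. ennreal \<bar>?S1 \<nu>\<bar> \<partial>tree_law p) \<le>
        (\<integral>\<^sup>+\<nu>. ennreal (c / 2) + ennreal (1 / (2 * c)) * ennreal ((?S1 \<nu>)\<^sup>2) \<partial>tree_law p)"
      by (intro nn_integral_mono) auto
    also have "\<dots> = ennreal (c / 2) +
        ennreal (1 / (2 * c)) * ennreal (a ^ n * (\<integral>k. (g1 k)\<^sup>2 \<partial>measure_pmf p))"
      by (subst nn_integral_add)
        (auto simp: nn_integral_cmult T.emeasure_space_1[simplified]
          nn_integral_square_generation_sum[OF integrable_offspring g1(1,2,3)])
    also have "\<dots> \<le> ennreal (c / 2) + ennreal (1 / (2 * c)) * ennreal (a ^ n * (b ^ (2 * n) * a))"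
      using g1(4) an by (intro add_left_mono mult_left_mono ennreal_leI) auto
    also have "\<dots> = ennreal (c / 2 + 1 / (2 * c) * (a ^ n * (b ^ (2 * n) * a)))"
      using c b_gt_1 offspring_mean_gt_1 by (simp add: ennreal_mult[symmetric] ennreal_plus[symmetric] del: ennreal_plus)
    finally have "(\<integral>\<^sup>+\<nu>. ennreal \<bar>?S1 \<nu> / a ^ Suc n\<bar> \<partial>tree_law p) \<le>
        ennreal (1 / a ^ Suc n) * ennreal (c / 2 + 1 / (2 * c) * (a ^ n * (b ^ (2 * n) * a)))"
      unfolding scale by (intro mult_left_mono) auto
    also have "\<dots> = ennreal ((c / 2 + 1 / (2 * c) * (a ^ n * (b ^ (2 * n) * a))) / a ^ Suc n)"
      using c b_gt_1 offspring_mean_gt_1 an by (subst ennreal_mult[symmetric]) auto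
    also have "(c / 2 + 1 / (2 * c) * (a ^ n * (b ^ (2 * n) * a))) / a ^ Suc n =
        (1 / b) ^ n * (1 / a + 1) / 2"
    proof -
      have a: "a ^ n = b ^ (4 * n)"
        by (simp add: b_power_4[symmetric] power_mult)
      have *: "c = b ^ n * b ^ (2 * n)" "b ^ (4 * n) = b ^ n * b ^ n * b ^ (2 * n)"
        by (simp_all add: c_def power_add[symmetric])
      show ?thesis
        using b_gt_1 offspring_mean_gt_1 unfolding power_Suc a *
        by (simp add: field_simps power_one_over power2_eq_square power_mult)
    qed
    also have "\<dots> \<le> (1 / b) ^ n"
    proof -
      have "1 / a + 1 \<le> 2"
        using offspring_mean_gt_1 by simp
      then have "(1 / b) ^ n * (1 / a + 1) \<le> (1 / b) ^ n * 2"
        using b_gt_1 by (intro mult_left_mono) auto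
      then show ?thesis
        by simp
    qed
    finally show ?thesis
      by (simp add: ennreal_leI)
  qed

  have "(\<integral>\<^sup>+\<nu>. ennreal \<bar>increment n \<nu>\<bar> \<partial>tree_law p) \<le>
      (\<integral>\<^sup>+\<nu>. ennreal \<bar>?S1 \<nu> / a ^ Suc n\<bar> + ennreal \<bar>?S2 \<nu> / a ^ Suc n\<bar> \<partial>tree_law p)"
    unfolding inc
    by (intro nn_integral_mono)
      (simp add: ennreal_plus[symmetric] ennreal_leI abs_triangle_ineq del: ennreal_plus power_Suc abs_divide)
  also have "\<dots> = (\<integral>\<^sup>+\<nu>. ennreal \<bar>?S1 \<nu> / a ^ Suc n\<bar> \<partial>tree_law p) +
      (\<integral>\<^sup>+\<nu>. ennreal \<bar>?S2 \<nu> / a ^ Suc n\<bar> \<partial>tree_law p)"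
    by (intro nn_integral_add) auto
  also have "\<dots> \<le> ennreal ((1 / b) ^ n) + 2 * (\<integral>\<^sup>+k. ennreal (tail n k) \<partial>measure_pmf p)"
    by (intro add_mono part1 part2)
  finally show ?thesis
    by (simp add: add.commute)
qed

lemma suminf_nn_integral_increment:
  "(\<Sum>n. \<integral>\<^sup>+\<nu>. ennreal \<bar>increment n \<nu>\<bar> \<partial>tree_law p) < \<infinity>"
proof -
  have "(\<Sum>n. \<integral>\<^sup>+\<nu>. ennreal \<bar>increment n \<nu>\<bar> \<partial>tree_law p) \<le>
      (\<Sum>n. 2 * (\<integral>\<^sup>+k. ennreal (tail n k) \<partial>measure_pmf p) + ennreal ((1 / b) ^ n))"
    by (intro suminf_le nn_integral_increment) auto
  also have "\<dots> = 2 * (\<Sum>n. \<integral>\<^sup>+k. ennreal (tail n k) \<partial>measure_pmf p) + (\<Sum>n. ennreal ((1 / b) ^ n))"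
    by (simp add: suminf_add[symmetric])
  also have "\<dots> < \<infinity>"
  proof -
    have "summable (\<lambda>n. (1 / b) ^ n)"
      using b_gt_1 by (intro summable_geometric) simp
    then have "(\<Sum>n. ennreal ((1 / b) ^ n)) < \<infinity>"
      using b_gt_1 by (subst suminf_ennreal2) auto
    then show ?thesis
      using suminf_nn_integral_tail by (simp add: ennreal_mult_less_top)
  qed
  finally show ?thesis .
qed

section \<open>Existence and mean of the limit on the canonical space\<close>

abbreviation "W \<equiv> gw_limit p (\<lambda>u \<nu>. \<nu> u)"

abbreviation "K \<equiv> gw_first_excess p (\<lambda>u \<nu>. \<nu> u)"

lemma W_eq_lim: "W = (\<lambda>\<nu>. lim (\<lambda>n. normalized n \<nu>))"
  by (simp add: gw_limit_def normalized_def fun_eq_iff)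

lemma measurable_W [measurable]: "W \<in> borel_measurable (tree_law p)"
  unfolding W_eq_lim by measurable

lemma sets_W: "A \<in> sets borel \<Longrightarrow> {\<nu>. W \<nu> \<in> A} \<in> sets (tree_law p)"
  using measurable_sets[OF measurable_W, of A] by (simp add: vimage_def)

lemma sum_increment: "normalized n \<nu> = 1 + (\<Sum>i<n. increment i \<nu>)"
  by (induction n) (simp_all add: increment_def normalized_def)

lemma AE_summable_increment: "AE \<nu> in tree_law p. summable (\<lambda>n. \<bar>increment n \<nu>\<bar>)"
proof -
  have "(\<integral>\<^sup>+\<nu>. (\<Sum>n. ennreal \<bar>increment n \<nu>\<bar>) \<partial>tree_law p) \<noteq> \<infinity>"
    using suminf_nn_integral_increment by (subst nn_integral_suminf) auto
  then have "AE \<nu> in tree_law p. (\<Sum>n. ennreal \<bar>increment n \<nu>\<bar>) \<noteq> \<infinity>"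
    by (intro nn_integral_PInf_AE) auto
  then show ?thesis
    by eventually_elim (auto intro: summable_suminf_not_top)
qed

lemma increment_limit:
  assumes "summable (\<lambda>n. \<bar>increment n \<nu>\<bar>)"
  shows "(\<lambda>n. normalized n \<nu>) \<longlonglongrightarrow> W \<nu>" and "W \<nu> = 1 + (\<Sum>n. increment n \<nu>)"
proof -
  have "(\<lambda>n. normalized n \<nu>) \<longlonglongrightarrow> 1 + (\<Sum>n. increment n \<nu>)"
    unfolding sum_increment
    using summable_rabs_cancel[OF assms] by (intro tendsto_add tendsto_const summable_LIMSEQ)
  then show "(\<lambda>n. normalized n \<nu>) \<longlonglongrightarrow> W \<nu>" "W \<nu> = 1 + (\<Sum>n. increment n \<nu>)"
    unfolding W_eq_lim by (simp_all add: limI)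
qed

lemma integrable_increment: "integrable (tree_law p) (increment n)"
proof -
  have "integrable (measure_pmf p) (\<lambda>k. real k - a)"
    using integrable_offspring by simp
  then show ?thesis
    unfolding increment_eq[abs_def] by (intro integrable_divide integrable_generation_sum integrable_offspring)
qed

lemma integral_increment: "(\<integral>\<nu>. increment n \<nu> \<partial>tree_law p) = 0"
proof -
  have "integrable (measure_pmf p) (\<lambda>k. real k - a)" "(\<integral>k. real k - a \<partial>measure_pmf p) = 0"
    using integrable_offspring by (simp_all add: offspring_mean_def)
  then show ?thesis
    unfolding increment_eq by (simp add: integral_generation_sum[OF integrable_offspring] del: power_Suc)
qed

text \<open>Summability of the increments in mean permits exchanging series and integral, so the
  mean 1 survives in the limit. Later it is the mean that prevents W from vanishing almost
  surely.\<close>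

lemma integral_W: "integrable (tree_law p) W" "(\<integral>\<nu>. W \<nu> \<partial>tree_law p) = 1"
proof -
  interpret T: prob_space "tree_law p"
    by (rule prob_space_tree_law)
  have eq: "ennreal (\<integral>\<nu>. \<bar>increment n \<nu>\<bar> \<partial>tree_law p) = (\<integral>\<^sup>+\<nu>. ennreal \<bar>increment n \<nu>\<bar> \<partial>tree_law p)" for n
    using integrable_increment by (subst nn_integral_eq_integral) auto
  have sum: "summable (\<lambda>n. \<integral>\<nu>. norm (increment n \<nu>) \<partial>tree_law p)"
    using suminf_nn_integral_increment by (intro summable_suminf_not_top) (auto simp: eq)
  have AE: "AE \<nu> in tree_law p. summable (\<lambda>n. norm (increment n \<nu>))"
    using AE_summable_increment by simp
  have AE_eq: "AE \<nu> in tree_law p. 1 + (\<Sum>n. increment n \<nu>) = W \<nu>"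
    using AE_summable_increment by eventually_elim (simp add: increment_limit(2))
  have int: "integrable (tree_law p) (\<lambda>\<nu>. \<Sum>n. increment n \<nu>)"
    by (rule integrable_suminf[OF integrable_increment AE sum])
  have [measurable]: "(\<lambda>\<nu>. \<Sum>n. increment n \<nu>) \<in> borel_measurable (tree_law p)"
    using int by auto
  show "integrable (tree_law p) W"
    using AE_eq int by (subst integrable_cong_AE[of _ _ "\<lambda>\<nu>. 1 + (\<Sum>n. increment n \<nu>)"]) auto
  have "(\<integral>\<nu>. W \<nu> \<partial>tree_law p) = (\<integral>\<nu>. 1 + (\<Sum>n. increment n \<nu>) \<partial>tree_law p)"
    using AE_eq by (intro integral_cong_AE) auto
  also have "\<dots> = 1 + (\<Sum>n. \<integral>\<nu>. increment n \<nu> \<partial>tree_law p)"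
    using int T.prob_space by (simp add: integral_suminf[OF integrable_increment AE sum])
  also have "\<dots> = 1"
    by (simp add: integral_increment)
  finally show "(\<integral>\<nu>. W \<nu> \<partial>tree_law p) = 1" .
qed

lemma AE_limit: "AE \<nu> in tree_law p. (\<lambda>n. normalized n \<nu>) \<longlonglongrightarrow> W \<nu> \<and> 0 \<le> W \<nu>"
  using AE_summable_increment
proof eventually_elim
  case (elim \<nu>)
  have "0 \<le> normalized n \<nu>" for n
    using offspring_mean_gt_1 by (simp add: normalized_def)
  then show ?case
    using increment_limit(1)[OF elim] by (auto intro: LIMSEQ_le_const)
qed

section \<open>The recursion for the limit and its positivity\<close>

lemma W_graft:
  assumes "\<And>i. (\<lambda>n. normalized n (s i)) \<longlonglongrightarrow> W (s i)"
  shows "W (graft m s) = (\<Sum>i<m. W (s i)) / a"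
proof -
  \<comment> \<open>Generation \<open>Suc n\<close> of the grafted tree consists of the generations
    \<open>n\<close> of the subtrees, and its normalization has one more factor
    \<open>a\<close>.\<close>
  have "normalized (Suc n) (graft m s) = (\<Sum>i<m. normalized n (s i)) / a" for n
    unfolding normalized_def generation_Suc_graft
    by (simp add: sum_divide_distrib divide_divide_eq_left mult.commute)
  then have "(\<lambda>n. normalized (Suc n) (graft m s)) \<longlonglongrightarrow> (\<Sum>i<m. W (s i)) / a"
    using assms offspring_mean_gt_1 by (auto intro!: tendsto_intros)
  then show ?thesis
    unfolding W_eq_lim by (intro limI) (rule LIMSEQ_imp_Suc)
qed

lemma AE_forest_W:
  "AE s in forest_law p. (\<forall>i. 0 \<le> W (s i)) \<and> (\<forall>m. W (graft m s) = (\<Sum>i<m. W (s i)) / a)"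
proof -
  have "AE s in forest_law p. \<forall>i. (\<lambda>n. normalized n (s i)) \<longlonglongrightarrow> W (s i) \<and> 0 \<le> W (s i)"
    using AE_forest_component[OF AE_limit] by (simp add: AE_all_countable)
  then show ?thesis
    by eventually_elim (auto intro: W_graft)
qed

text \<open>In the hypothesis on \<open>A\<close> and \<open>B\<close>, \<open>v\<close> stands for
  the sum over the subtrees and \<open>w\<close> for one summand: summands are nonnegative, so each
  of them falls into \<open>B\<close> once the total falls into \<open>A\<close>. Abstract sets
  allow one proof for the half-lines below \<open>x\<close> and for the values at or below
  0.\<close>

lemma measure_W_contract:
  assumes [measurable]: "A \<in> sets borel" "B \<in> sets borel"
    and AB: "\<And>w v. 0 \<le> w \<Longrightarrow> w \<le> v \<Longrightarrow> v / a \<in> A \<Longrightarrow> w \<in> B"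
  shows "measure (tree_law p) {\<nu>. W \<nu> \<in> A} \<le>
    q * measure (tree_law p) {\<nu>. W \<nu> \<in> B} + (1 - q) * (measure (tree_law p) {\<nu>. W \<nu> \<in> B})\<^sup>2"
proof -
  interpret T: prob_space "tree_law p"
    by (rule prob_space_tree_law)
  interpret F: prob_space "forest_law p"
    by (rule prob_space_forest_law)
  have sets: "{\<nu>. W \<nu> \<in> A} \<in> sets (tree_law p)" "{\<nu>. W \<nu> \<in> B} \<in> sets (tree_law p)"
    by (simp_all add: sets_W)
  define P where "P = measure (tree_law p) {\<nu>. W \<nu> \<in> B}"
  \<comment> \<open>Only the first \<open>k\<close> of the \<open>m\<close> subtrees are
    constrained. The choice \<open>k = 1\<close> serves a single child, \<open>k = 2\<close> all
    larger families.\<close>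
  have forest: "emeasure (forest_law p) {s. W (graft m s) \<in> A} \<le> ennreal (P ^ k)" if "k \<le> m" for m k
  proof -
    have "emeasure (forest_law p) {s. W (graft m s) \<in> A} \<le>
        emeasure (forest_law p) {s. \<forall>i\<in>{..<k}. s i \<in> {\<nu>. W \<nu> \<in> B}}"
    proof (rule emeasure_mono_AE)
      show "AE s in forest_law p. s \<in> {s. W (graft m s) \<in> A} \<longrightarrow>
          s \<in> {s. \<forall>i\<in>{..<k}. s i \<in> {\<nu>. W \<nu> \<in> B}}"
        using AE_forest_W
      proof eventually_elim
        case (elim s)
        have "W (s i) \<le> (\<Sum>i<m. W (s i))" if "i < k" for i
          using elim that \<open>k \<le> m\<close> by (intro member_le_sum) auto
        then show ?case
          using elim AB by auto
      qed
      have "{s \<in> space (forest_law p). \<forall>i\<in>{..<k}. s i \<in> {\<nu>. W \<nu> \<in> B}} \<in> sets (forest_law p)"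
        by measurable
      then show "{s. \<forall>i\<in>{..<k}. s i \<in> {\<nu>. W \<nu> \<in> B}} \<in> sets (forest_law p)"
        by simp
    qed
    also have "\<dots> = ennreal (P ^ k)"
      using emeasure_forest_inter[of "{..<k}" "{\<nu>. W \<nu> \<in> B}" p] sets
      by (simp add: P_def T.emeasure_eq_measure ennreal_power)
    finally show ?thesis .
  qed
  have P: "P\<^sup>2 \<le> P"
    unfolding power2_eq_square P_def by (intro mult_left_le_one_le) auto
  \<comment> \<open>The dominating function is \<open>P\<close> at \<open>m = 1\<close> and
    \<open>P\<^sup>2\<close> elsewhere, written as the constant \<open>P\<^sup>2\<close> plus a
    correction at 1.\<close>
  have int1: "integrable (measure_pmf p) (\<lambda>m. (P - P\<^sup>2) * indicator {1} m)"
    by (intro integrable_mult_right integrable_real_indicator) (auto simp: measure_pmf.emeasure_eq_measure)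
  have "ennreal (measure (tree_law p) {\<nu>. W \<nu> \<in> A}) =
      (\<integral>\<^sup>+m. emeasure (forest_law p) {s. W (graft m s) \<in> A} \<partial>measure_pmf p)"
    using emeasure_tree_law(1)[OF sets(1)] by (simp add: T.emeasure_eq_measure)
  also have "\<dots> \<le> (\<integral>\<^sup>+m. ennreal (P\<^sup>2 + (P - P\<^sup>2) * indicator {1} m) \<partial>measure_pmf p)"
  proof (intro nn_integral_mono_AE, unfold AE_measure_pmf_iff, intro ballI)
    fix m assume "m \<in> set_pmf p"
    then have "m = 1 \<or> m \<ge> 2"
      using offspring_pos by fastforce
    then show "emeasure (forest_law p) {s. W (graft m s) \<in> A} \<le> ennreal (P\<^sup>2 + (P - P\<^sup>2) * indicator {1} m)"
      using forest[of 1 m] forest[of 2 m] by auto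
  qed
  also have "\<dots> = ennreal (\<integral>m. P\<^sup>2 + (P - P\<^sup>2) * indicator {1} m \<partial>measure_pmf p)"
  proof (rule nn_integral_eq_integral)
    show "AE m in measure_pmf p. 0 \<le> P\<^sup>2 + (P - P\<^sup>2) * indicator {1} m"
      using P by (intro AE_I2) auto
  qed (use int1 in simp)
  also have "(\<integral>m. P\<^sup>2 + (P - P\<^sup>2) * indicator {1} m \<partial>measure_pmf p) = P\<^sup>2 + (P - P\<^sup>2) * q"
    using int1 by (subst Bochner_Integration.integral_add) (simp_all add: measure_pmf_single)
  finally have "measure (tree_law p) {\<nu>. W \<nu> \<in> A} \<le> P\<^sup>2 + (P - P\<^sup>2) * q"
    using P pmf_1_pos by (subst (asm) ennreal_le_iff) simp_all
  then show ?thesis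
    by (simp add: P_def algebra_simps)
qed

text \<open>The mass \<open>r\<close> at or below 0 satisfies
  \<open>r \<le> q * r + (1 - q) * r\<^sup>2\<close>, which leaves only 0 and 1; the value 1
  contradicts the mean of W.\<close>

lemma AE_W_pos: "AE \<nu> in tree_law p. W \<nu> > 0"
proof -
  interpret T: prob_space "tree_law p"
    by (rule prob_space_tree_law)
  define r where "r = measure (tree_law p) {\<nu>. W \<nu> \<in> {..0}}"
  have "r \<le> q * r + (1 - q) * r\<^sup>2"
    unfolding r_def using offspring_mean_gt_1
    by (intro measure_W_contract) (auto simp: divide_le_0_iff)
  then have "(1 - q) * (r * (1 - r)) \<le> 0"
    by (simp add: power2_eq_square algebra_simps)
  then have "r * (1 - r) \<le> 0"
    using pmf_1_less by (simp add: mult_le_0_iff)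
  moreover have "r \<ge> 0" "r \<le> 1"
    by (simp_all add: r_def)
  moreover have "r \<noteq> 1"
  proof
    assume "r = 1"
    then have "AE \<nu> in tree_law p. W \<nu> \<le> 0"
      using sets_W[of "{..0}"] by (subst T.prob_Collect_eq_1[symmetric]) (auto simp: r_def)
    then have "(\<integral>\<nu>. W \<nu> \<partial>tree_law p) \<le> (\<integral>\<nu>. 0 \<partial>tree_law p)"
      using integral_W(1) by (intro integral_mono_AE) auto
    then show False
      using integral_W(2) by simp
  qed
  ultimately have "r = 0"
    by (auto simp: mult_le_0_iff)
  then have "AE \<nu> in tree_law p. \<not> W \<nu> \<le> 0"
    using sets_W[of "{..0}"] by (subst T.prob_Collect_eq_0[symmetric]) (auto simp: r_def)
  then show ?thesis
    by (simp add: not_le)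
qed

subsection \<open>Small values of the limit\<close>

definition cdf_W :: "real \<Rightarrow> real" where
  "cdf_W x = measure (tree_law p) {\<nu>. W \<nu> < x}"

lemma sets_W_less: "{\<nu>. W \<nu> < x} \<in> sets (tree_law p)"
  using sets_W[of "{..<x}"] by simp

lemma cdf_W_nonneg: "cdf_W x \<ge> 0" and cdf_W_le_1: "cdf_W x \<le> 1"
proof -
  interpret T: prob_space "tree_law p"
    by (rule prob_space_tree_law)
  show "cdf_W x \<ge> 0" "cdf_W x \<le> 1"
    by (simp_all add: cdf_W_def)
qed

lemma cdf_W_mono: "x \<le> y \<Longrightarrow> cdf_W x \<le> cdf_W y"
proof -
  interpret T: prob_space "tree_law p"
    by (rule prob_space_tree_law)
  show "x \<le> y \<Longrightarrow> cdf_W x \<le> cdf_W y"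
    unfolding cdf_W_def by (intro T.finite_measure_mono sets_W_less) auto
qed

lemma cdf_W_upper: "cdf_W x \<le> q * cdf_W (a * x) + (1 - q) * (cdf_W (a * x))\<^sup>2"
  using measure_W_contract[of "{..<x}" "{..<a * x}"] offspring_mean_gt_1
  by (simp add: cdf_W_def field_simps)

text \<open>Only trees with a single root child are counted; for them W is the limit of the subtree
  divided by \<open>a\<close>.\<close>

lemma cdf_W_lower: "q * cdf_W (a * x) \<le> cdf_W x"
proof -
  interpret F: prob_space "forest_law p"
    by (rule prob_space_forest_law)
  have "measure (forest_law p) {s. s 0 \<in> {\<nu>. W \<nu> < a * x}} = cdf_W (a * x)"
    unfolding cdf_W_def by (rule measure_forest_component[OF sets_W_less])
  moreover have "measure (forest_law p) {s. s 0 \<in> {\<nu>. W \<nu> < a * x}} =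
      measure (forest_law p) {s. graft 1 s \<in> {\<nu>. W \<nu> < x}}"
  proof (rule F.finite_measure_eq_AE)
    show "AE s in forest_law p. s \<in> {s. s 0 \<in> {\<nu>. W \<nu> < a * x}} \<longleftrightarrow> s \<in> {s. graft 1 s \<in> {\<nu>. W \<nu> < x}}"
      using AE_forest_W
    proof eventually_elim
      case (elim s)
      then have "W (graft 1 s) = W (s 0) / a"
        by (simp add: lessThan_Suc)
      then show ?case
        using offspring_mean_gt_1 by (simp add: pos_divide_less_eq mult.commute)
    qed
    show "{s. s 0 \<in> {\<nu>. W \<nu> < a * x}} \<in> sets (forest_law p)"
      using sets_W_less[of "a * x"]
        measurable_sets[OF measurable_component_singleton[of "0::nat" UNIV "\<lambda>_. tree_law p"], of "{\<nu>. W \<nu> < a * x}"]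
      by (simp add: vimage_def)
  qed (rule emeasure_tree_law(2)[OF sets_W_less])
  ultimately show ?thesis
    using measure_tree_law_ge[OF sets_W_less, of 1 x] by (simp add: cdf_W_def)
qed

lemma cdf_W_lower_power: "q ^ n * cdf_W (a ^ n * x) \<le> cdf_W x"
proof (induction n arbitrary: x)
  case (Suc n)
  have "q ^ Suc n * cdf_W (a ^ Suc n * x) = q * (q ^ n * cdf_W (a ^ n * (a * x)))"
    by (simp add: ac_simps)
  also have "\<dots> \<le> q * cdf_W (a * x)"
    using pmf_1_pos by (intro mult_left_mono Suc) auto
  also have "\<dots> \<le> cdf_W x"
    by (rule cdf_W_lower)
  finally show ?case .
qed simp

text \<open>With mean 1, W cannot be at least 2 almost surely. The lower recursion then carries
  positivity down to every positive threshold.\<close>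

lemma cdf_W_2_pos: "cdf_W 2 > 0"
proof (rule ccontr)
  interpret T: prob_space "tree_law p"
    by (rule prob_space_tree_law)
  assume "\<not> cdf_W 2 > 0"
  then have "measure (tree_law p) {\<nu>. W \<nu> < 2} = 0"
    by (simp add: cdf_W_def not_less measure_le_0_iff)
  then have "AE \<nu> in tree_law p. \<not> W \<nu> < 2"
    using sets_W_less by (subst T.prob_Collect_eq_0[symmetric]) auto
  then have "(\<integral>\<nu>. 2 \<partial>tree_law p) \<le> (\<integral>\<nu>. W \<nu> \<partial>tree_law p)"
    using integral_W(1) by (intro integral_mono_AE) auto
  then show False
    using integral_W(2) T.prob_space by simp
qed

lemma cdf_W_pos:
  assumes "x > 0"
  shows "cdf_W x > 0"
proof -
  obtain n where "2 / x < a ^ n"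
    using real_arch_pow[OF offspring_mean_gt_1] by blast
  then have "2 \<le> a ^ n * x"
    using assms by (simp add: field_simps)
  then have "0 < cdf_W (a ^ n * x)"
    using cdf_W_mono cdf_W_2_pos by (metis less_le_trans)
  then have "0 < q ^ n * cdf_W (a ^ n * x)"
    using pmf_1_pos by simp
  then show ?thesis
    using cdf_W_lower_power[of n x] by linarith
qed

text \<open>The events shrink to a null set because W is positive almost surely. Taking
  \<open>c = q\<close> gives the starting point below \<open>q\<close> that the contraction step
  requires.\<close>

lemma cdf_W_small:
  assumes "c > 0"
  shows "\<exists>x>0. cdf_W x < c"
proof -
  interpret T: prob_space "tree_law p"
    by (rule prob_space_tree_law)
  have "(\<lambda>n. measure (tree_law p) {\<nu>. W \<nu> < 1 / real (Suc n)}) \<longlonglongrightarrow>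
      measure (tree_law p) (\<Inter>n. {\<nu>. W \<nu> < 1 / real (Suc n)})"
    using sets_W_less
    by (intro T.finite_Lim_measure_decseq) (auto simp: decseq_def elim!: less_le_trans intro!: frac_le)
  moreover have "measure (tree_law p) (\<Inter>n. {\<nu>. W \<nu> < 1 / real (Suc n)}) = 0"
  proof -
    have "(\<Inter>n. {\<nu>. W \<nu> < 1 / real (Suc n)}) \<subseteq> {\<nu>. \<not> W \<nu> > 0}"
    proof
      fix \<nu> assume "\<nu> \<in> (\<Inter>n. {\<nu>. W \<nu> < 1 / real (Suc n)})"
      then have "W \<nu> < 1 / real (Suc n)" for n
        by blast
      then show "\<nu> \<in> {\<nu>. \<not> W \<nu> > 0}"
        using reals_Archimedean[of "W \<nu>"] by (metis inverse_eq_divide less_asym mem_Collect_eq)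
    qed
    then have "measure (tree_law p) (\<Inter>n. {\<nu>. W \<nu> < 1 / real (Suc n)}) \<le>
        measure (tree_law p) {\<nu>. \<not> W \<nu> > 0}"
      using sets_W[of "{..0}"] by (intro T.finite_measure_mono) (auto simp: not_less)
    also have "\<dots> = 0"
    proof (subst T.prob_eq_0)
      show "AE \<nu> in tree_law p. \<nu> \<notin> {\<nu>. \<not> W \<nu> > 0}"
        using AE_W_pos by eventually_elim simp
    qed (use sets_W[of "{..0}"] in \<open>simp add: not_less\<close>)
    finally show ?thesis
      using measure_nonneg order_antisym by blast
  qed
  ultimately have "(\<lambda>n. cdf_W (1 / real (Suc n))) \<longlonglongrightarrow> 0"
    by (simp add: cdf_W_def)
  then have "eventually (\<lambda>n. cdf_W (1 / real (Suc n)) < c) sequentially"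
    using assms by (rule order_tendstoD)
  then obtain n where "cdf_W (1 / real (Suc n)) < c"
    by (auto simp: eventually_sequentially)
  then show ?thesis
    by (intro exI[of _ "1 / real (Suc n)"]) auto
qed

end

section \<open>Deviations of the first excess\<close>

text \<open>The substitution \<open>u / (q - u)\<close> absorbs the quadratic term, so that iterating the recursion loses
  only a constant factor against \<open>q ^ n\<close>.\<close>

lemma quadratic_contraction_step:
  fixes q u u' :: real
  assumes "0 < q" "q < 1" "0 \<le> u" "u < q" "0 \<le> u'" "u' \<le> q * u + (1 - q) * u\<^sup>2"
  shows "u' < q" and "u' / (q - u') \<le> q * (u / (q - u))"
proof -
  have "u' \<le> u * (q + (1 - q) * u)"
    using assms by (simp add: power2_eq_square algebra_simps)
  also have "\<dots> \<le> u * 1"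
  proof (rule mult_left_mono)
    have "(1 - q) * u \<le> (1 - q) * 1"
      using assms by (intro mult_left_mono) auto
    then show "q + (1 - q) * u \<le> 1"
      by simp
  qed (use assms in simp)
  finally show "u' < q"
    using assms by simp
  have "q - (1 - q) * u \<ge> 0"
    using assms mult_left_le_one_le[of u "1 - q"] by simp
  \<comment> \<open>Cleared of denominators, the goal is
    \<open>u' * (q - (1 - q) * u) \<le> u * q\<^sup>2\<close>. The factor on the left is conjugate
    to \<open>q + (1 - q) * u\<close>, so inserting the bound on \<open>u'\<close> produces a
    difference of squares.\<close>
  then have "u' * (q - (1 - q) * u) \<le> (q * u + (1 - q) * u\<^sup>2) * (q - (1 - q) * u)"
    using assms by (intro mult_right_mono) auto
  also have "\<dots> = u * (q\<^sup>2 - ((1 - q) * u)\<^sup>2)"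
    by (simp add: power2_eq_square algebra_simps)
  also have "\<dots> \<le> u * q\<^sup>2"
    using assms by (intro mult_left_mono) auto
  finally have "u' * (q - u) \<le> q * u * (q - u')"
    by (simp add: power2_eq_square algebra_simps)
  then show "u' / (q - u') \<le> q * (u / (q - u))"
    using assms \<open>u' < q\<close> by (simp add: divide_simps mult.commute)
qed

text \<open>The point is a bound free of \<open>y\<close>, since the centre of the sum will be
  \<gamma>, which tends to infinity. The sum is split at the integer part of
  \<open>y\<close>.\<close>

lemma two_sided_geometric:
  fixes r y :: real
  assumes r: "0 < r" "r < 1" and y: "0 \<le> y"
  shows "summable (\<lambda>k. r powr \<bar>real k - y\<bar>)"
    and "(\<Sum>k. r powr \<bar>real k - y\<bar>) \<le> 1 / (r * (1 - r)) + 1 / (1 - r)"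
proof -
  define m where "m = nat \<lfloor>y\<rfloor>"
  have m: "real m \<le> y" "y < real m + 1"
    using y by (simp_all add: m_def)
  have geo: "summable (\<lambda>j. r ^ j)" "(\<Sum>j. r ^ j) = 1 / (1 - r)"
    using r by (simp_all add: summable_geometric suminf_geometric)
  \<comment> \<open>From \<open>y < real m + 1\<close> the distance of \<open>j + m\<close> to
    \<open>y\<close> exceeds \<open>j - 1\<close>; the lost unit is the factor
    \<open>1 / r\<close>.\<close>
  have right: "r powr \<bar>real (j + m) - y\<bar> \<le> (1 / r) * r ^ j" for j
  proof -
    have "r powr \<bar>real (j + m) - y\<bar> \<le> r powr (real j - 1)"
      using r m by (intro powr_mono') auto
    also have "\<dots> = (1 / r) * r ^ j"
      using r by (simp add: powr_diff powr_realpow)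
    finally show ?thesis .
  qed
  have sum1: "summable (\<lambda>j. r powr \<bar>real (j + m) - y\<bar>)"
    by (rule summable_comparison_test'[OF summable_mult[OF geo(1), of "1 / r"], of 0]) (use right in auto)
  then show sum: "summable (\<lambda>k. r powr \<bar>real k - y\<bar>)"
    by (subst summable_iff_shift[symmetric, of _ m])
  have "(\<Sum>j. r powr \<bar>real (j + m) - y\<bar>) \<le> (\<Sum>j. (1 / r) * r ^ j)"
    by (intro suminf_le right sum1 summable_mult geo(1))
  also have "\<dots> = 1 / (r * (1 - r))"
    by (simp only: suminf_mult[OF geo(1)] geo(2)) simp
  finally have 1: "(\<Sum>j. r powr \<bar>real (j + m) - y\<bar>) \<le> 1 / (r * (1 - r))" .
  have "(\<Sum>i<m. r powr \<bar>real i - y\<bar>) \<le> (\<Sum>i<m. r ^ (m - Suc i))"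
  proof (rule sum_mono)
    fix i assume "i \<in> {..<m}"
    then have "r powr \<bar>real i - y\<bar> \<le> r powr real (m - Suc i)"
      using r m by (intro powr_mono') (auto simp: of_nat_diff)
    then show "r powr \<bar>real i - y\<bar> \<le> r ^ (m - Suc i)"
      using r by (simp add: powr_realpow)
  qed
  also have "\<dots> = (\<Sum>i<m. r ^ i)"
    by (rule sum.nat_diff_reindex)
  also have "\<dots> \<le> (\<Sum>j. r ^ j)"
    using r by (intro sum_le_suminf geo) auto
  finally have 2: "(\<Sum>i<m. r powr \<bar>real i - y\<bar>) \<le> 1 / (1 - r)"
    by (simp add: geo)
  show "(\<Sum>k. r powr \<bar>real k - y\<bar>) \<le> 1 / (r * (1 - r)) + 1 / (1 - r)"
    using suminf_split_initial_segment[OF sum, of m] 1 2 by simp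
qed

text \<open>The constant \<open>D\<close> is traded for a smaller rate. For large \<open>x\<close>
  half of the decay outweighs \<open>D\<close>; on the remaining bounded range the gap \<delta>
  suffices, through \<open>1 - \<delta> \<le> exp (- \<delta>)\<close>.\<close>

lemma exponential_bound:
  fixes r \<delta> D :: real
  assumes "0 < r" "r < 1" "0 < \<delta>" "0 < D"
  shows "\<exists>\<theta>>0. \<forall>x\<ge>1. \<forall>P. P \<le> 1 - \<delta> \<longrightarrow> P \<le> D * r powr x \<longrightarrow> P \<le> exp (- \<theta> * x)"
proof -
  define L where "L = - ln r"
  have L: "L > 0"
    using assms by (simp add: L_def)
  \<comment> \<open>Beyond \<open>2 * ln D / L\<close> the constant \<open>D\<close> is at most
    \<open>exp (L / 2 * x)\<close>. The maximum with 1 keeps the divisor in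
    \<open>\<delta> / x0\<close> positive.\<close>
  define x0 where "x0 = max 1 (2 * ln D / L)"
  define \<theta> where "\<theta> = min (L / 2) (\<delta> / x0)"
  have x0: "x0 \<ge> 1" "2 * ln D / L \<le> x0"
    by (simp_all add: x0_def)
  have \<theta>: "\<theta> > 0"
    using L x0 assms by (simp add: \<theta>_def)
  have \<theta>_le: "\<theta> \<le> L / 2" "\<theta> \<le> \<delta> / x0"
    unfolding \<theta>_def by (rule min.cobounded1, rule min.cobounded2)
  have "P \<le> exp (- \<theta> * x)" if "x \<ge> 1" "P \<le> 1 - \<delta>" "P \<le> D * r powr x" for x P
  proof (cases "x \<le> x0")
    case True
    then have "\<theta> * x \<le> \<delta> / x0 * x0"
      using \<theta> \<theta>_le x0 that assms by (intro mult_mono) auto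
    then have "- \<delta> \<le> - \<theta> * x"
      using x0 by simp
    moreover have "1 + - \<delta> \<le> exp (- \<delta>)"
      by (rule exp_ge_add_one_self)
    ultimately show ?thesis
      using that(2) by (smt (verit) exp_le_cancel_iff)
  next
    case False
    then have "2 * ln D / L \<le> x"
      using x0 by simp
    then have "ln D \<le> L / 2 * x"
      using L by (simp add: field_simps)
    moreover have "\<theta> * x \<le> L / 2 * x"
      using \<theta>_le that by (intro mult_right_mono) auto
    ultimately have "ln D - L * x \<le> - \<theta> * x"
      by simp
    moreover have "D * r powr x = exp (ln D - L * x)"
      using assms by (simp add: L_def powr_def exp_add mult.commute)
    ultimately show ?thesis
      using that(3) by (smt (verit) exp_le_cancel_iff)
  qed
  then show ?thesis
    using \<theta> by blast
qed

section \<open>Exact order of the distribution function at zero\<close>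

context offspring_law
begin

text \<open>Along the thresholds \<open>x0 / a ^ n\<close> the quotient
  \<open>u n / (q - u n)\<close> shrinks by at least the factor \<open>q\<close> per step.
  Monotonicity of the distribution function fills in the thresholds between.\<close>

lemma cdf_W_upper_powr: "\<exists>C>0. \<forall>y. cdf_W (a powr (- y)) \<le> C * q powr y"
proof -
  obtain x0 where x0: "x0 > 0" "cdf_W x0 < q"
    using cdf_W_small[OF pmf_1_pos] by blast
  define u where "u n = cdf_W (x0 / a ^ n)" for n
  define D where "D = u 0 / (q - u 0)"
  have u: "u n < q \<and> u n / (q - u n) \<le> D * q ^ n" for n
  proof (induction n)
    case 0
    then show ?case
      using x0 by (simp add: u_def D_def)
  next
    case (Suc n)
    have "a * (x0 / a ^ Suc n) = x0 / a ^ n"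
      using offspring_mean_gt_1 by simp
    then have "u (Suc n) \<le> q * u n + (1 - q) * (u n)\<^sup>2"
      using cdf_W_upper[of "x0 / a ^ Suc n"] by (simp only: u_def)
    note step = quadratic_contraction_step[OF pmf_1_pos pmf_1_less _ _ _ this]
    have "u (Suc n) / (q - u (Suc n)) \<le> q * (u n / (q - u n))"
      using Suc by (intro step) (auto simp: u_def cdf_W_nonneg)
    also have "\<dots> \<le> q * (D * q ^ n)"
      using Suc pmf_1_pos by (intro mult_left_mono) auto
    finally show ?case
      using step(1) Suc by (auto simp: u_def cdf_W_nonneg ac_simps)
  qed
  have u_le: "u n \<le> D * q ^ n" for n
  proof -
    have "u n \<ge> 0"
      by (simp add: u_def cdf_W_nonneg)
    then have "u n * (q - u n) \<le> u n * 1"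
      using pmf_1_less by (intro mult_left_mono) auto
    then have "u n \<le> u n / (q - u n)"
      using u[of n] by (simp add: field_simps)
    then show ?thesis
      using u[of n] by linarith
  qed
  have D: "D \<ge> 0"
    using u[of 0] cdf_W_nonneg by (auto simp: D_def u_def)
  define y0 where "y0 = - log a x0"
  have x0_eq: "x0 = a powr (- y0)"
    using x0 offspring_mean_gt_1 by (simp add: y0_def)
  \<comment> \<open>The 1 in the exponent comes from rounding \<open>y - y0\<close> down. The 1 in
    \<open>D + 1\<close> serves \<open>y < y0\<close>, where the power of \<open>q\<close> is at
    least 1 and the trivial bound on a probability suffices.\<close>
  have le: "cdf_W (a powr (- y)) \<le> (D + 1) * q powr (y - y0 - 1)" for y
  proof (cases "y0 \<le> y")
    case True
    define n where "n = nat \<lfloor>y - y0\<rfloor>"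
    have n: "real n \<le> y - y0" "y - y0 - 1 \<le> real n"
      using True by (simp_all add: n_def)
    have "x0 / a ^ n = a powr (- y0 - real n)"
      using offspring_mean_gt_1 by (simp add: x0_eq powr_diff powr_realpow)
    then have "a powr (- y) \<le> x0 / a ^ n"
      using n offspring_mean_gt_1 by simp
    then have "cdf_W (a powr (- y)) \<le> u n"
      unfolding u_def by (rule cdf_W_mono)
    also have "\<dots> \<le> D * q ^ n"
      by (rule u_le)
    also have "q ^ n = q powr real n"
      using pmf_1_pos by (simp add: powr_realpow)
    also have "D * q powr real n \<le> (D + 1) * q powr (y - y0 - 1)"
      using D n pmf_1_pos pmf_1_less by (intro mult_mono powr_mono') auto
    finally show ?thesis .
  next
    case False
    have "cdf_W (a powr (- y)) \<le> 1 * q powr 0"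
      using pmf_1_pos by (simp add: cdf_W_le_1)
    also have "\<dots> \<le> (D + 1) * q powr (y - y0 - 1)"
      using False D pmf_1_pos pmf_1_less by (intro mult_mono powr_mono') auto
    finally show ?thesis .
  qed
  have "(D + 1) * q powr (y - y0 - 1) = (D + 1) * q powr (- y0 - 1) * q powr y" for y
  proof -
    have "y - y0 - 1 = (- y0 - 1) + y"
      by simp
    then show ?thesis
      by (simp only: powr_add mult.assoc)
  qed
  then have "cdf_W (a powr (- y)) \<le> (D + 1) * q powr (- y0 - 1) * q powr y" for y
    using le[of y] by (simp only:)
  moreover have "(D + 1) * q powr (- y0 - 1) > 0"
    using D pmf_1_pos by simp
  ultimately show ?thesis
    by blast
qed

text \<open>After \<open>n\<close> single births, with \<open>n\<close> the ceiling of
  \<open>y\<close>, the rescaled threshold is at least 1. Rounding up costs one factor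
  \<open>q\<close>, hence the constant \<open>q * cdf_W 1\<close>.\<close>

lemma cdf_W_lower_powr: "\<exists>c>0. \<forall>y\<ge>0. c * q powr y \<le> cdf_W (a powr (- y))"
proof (intro exI conjI allI impI)
  show "q * cdf_W 1 > 0"
    using pmf_1_pos cdf_W_pos by simp
  fix y :: real assume "y \<ge> 0"
  define n where "n = nat \<lceil>y\<rceil>"
  have n: "y \<le> real n" "real n \<le> y + 1"
    using \<open>y \<ge> 0\<close> by (simp_all add: n_def)
  have "a powr 0 \<le> a powr (real n - y)"
    using n offspring_mean_gt_1 by (intro powr_mono) auto
  also have "a powr (real n - y) = a ^ n * a powr (- y)"
    using offspring_mean_gt_1 by (simp add: powr_diff powr_minus powr_realpow divide_inverse)
  finally have "cdf_W 1 \<le> cdf_W (a ^ n * a powr (- y))"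
    using offspring_mean_gt_1 by (intro cdf_W_mono) simp
  moreover have "q powr (y + 1) \<le> q ^ n"
    using n pmf_1_pos pmf_1_less by (simp add: powr_realpow[symmetric] powr_mono')
  ultimately have "q powr (y + 1) * cdf_W 1 \<le> q ^ n * cdf_W (a ^ n * a powr (- y))"
    by (intro mult_mono) (auto simp: cdf_W_nonneg)
  also have "\<dots> \<le> cdf_W (a powr (- y))"
    by (rule cdf_W_lower_power)
  finally show "q * cdf_W 1 * q powr y \<le> cdf_W (a powr (- y))"
    using pmf_1_pos by (simp add: powr_add ac_simps)
qed

subsection \<open>The first excess\<close>

lemma min_offspring_eq: "min_offspring p = 1"
  unfolding min_offspring_def
proof (rule Least_equality)
  fix n assume "0 < pmf p n"
  then show "1 \<le> n"
    using pmf_0 by (cases n) auto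
qed (rule pmf_1_pos)

lemma K_eq: "K \<nu> = (LEAST k. generation k \<nu> > 1)"
  by (simp add: gw_first_excess_def min_offspring_eq)

lemma measurable_K [measurable]: "K \<in> measurable (tree_law p) (count_space UNIV)"
proof -
  have "(\<lambda>\<nu>. LEAST k. generation k \<nu> > 1) \<in> measurable (tree_law p) (count_space UNIV)"
    by measurable
  then show ?thesis
    by (simp add: K_eq[abs_def])
qed

text \<open>If no generation exceeded 1, the normalized sizes would be at most
  \<open>(1 / a) ^ k\<close> and W could not be positive. Hence the \<open>LEAST\<close> in K is
  almost surely attained.\<close>

lemma AE_excess: "AE \<nu> in tree_law p. \<exists>k. generation k \<nu> > 1"
  using AE_limit AE_W_pos
proof eventually_elim
  case (elim \<nu>)
  show ?case
  proof (rule ccontr)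
    assume "\<nexists>k. generation k \<nu> > 1"
    then have le: "real (generation k \<nu>) \<le> 1" for k
      by (simp add: not_less)
    have "normalized k \<nu> \<le> (1 / a) ^ k" for k
      using le[of k] offspring_mean_gt_1 by (simp add: normalized_def power_one_over divide_right_mono)
    moreover have "(\<lambda>k. (1 / a) ^ k) \<longlonglongrightarrow> 0"
      using offspring_mean_gt_1 by (intro LIMSEQ_realpow_zero) auto
    ultimately have "W \<nu> \<le> 0"
      using elim by (intro LIMSEQ_le[of "\<lambda>k. normalized k \<nu>" _ "\<lambda>k. (1 / a) ^ k"]) auto
    then show False
      using elim by simp
  qed
qed

text \<open>The hypothesis makes the \<open>LEAST\<close> of the subtree a genuine minimum, which
  the additional root generation shifts by one.\<close>

lemma K_graft_1:
  assumes "generation k (s 0) > 1"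
  shows "K (graft 1 s) = Suc (K (s 0))"
proof -
  have "generation (Suc n) (graft 1 s) = generation n (s 0)" for n
    by (simp add: generation_Suc_graft lessThan_Suc)
  then show ?thesis
    unfolding K_eq using assms by (subst Least_Suc[of _ "Suc k"]) auto
qed

lemma K_graft_ge_2:
  assumes "m \<ge> 2"
  shows "K (graft m s) = 1"
  unfolding K_eq
proof (rule Least_equality)
  show "1 < generation 1 (graft m s)"
    using assms generation_Suc_graft[of 0 m s] by simp
  fix k assume "1 < generation k (graft m s)"
  then show "1 \<le> k"
    by (cases k) auto
qed

lemma K_pos:
  assumes "generation k \<nu> > 1"
  shows "K \<nu> \<ge> 1"
proof -
  have "generation (K \<nu>) \<nu> > 1"
    unfolding K_eq using assms by (rule LeastI)
  then show ?thesis
    by (cases "K \<nu>") auto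
qed

definition excess :: "nat \<Rightarrow> real \<Rightarrow> real" where
  "excess k x = measure (tree_law p) {\<nu>. K \<nu> = k \<and> W \<nu> < x}"

lemma sets_excess: "{\<nu>. K \<nu> = k \<and> W \<nu> < x} \<in> sets (tree_law p)"
proof -
  have "{\<nu> \<in> space (tree_law p). K \<nu> = k \<and> W \<nu> < x} \<in> sets (tree_law p)"
    by measurable
  then show ?thesis
    by simp
qed

lemma excess_nonneg: "excess k x \<ge> 0"
  by (simp add: excess_def)

lemma excess_mono: "x \<le> y \<Longrightarrow> excess k x \<le> excess k y"
proof -
  interpret T: prob_space "tree_law p"
    by (rule prob_space_tree_law)
  show "x \<le> y \<Longrightarrow> excess k x \<le> excess k y"
    unfolding excess_def by (intro T.finite_measure_mono sets_excess) auto
qed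

lemma excess_le_1: "excess k x \<le> 1"
proof -
  interpret T: prob_space "tree_law p"
    by (rule prob_space_tree_law)
  show ?thesis
    by (simp add: excess_def)
qed

lemma AE_forest_regular:
  "AE s in forest_law p. (\<forall>i. 0 \<le> W (s i) \<and> (\<exists>k. generation k (s i) > 1)) \<and>
    (\<forall>m. W (graft m s) = (\<Sum>i<m. W (s i)) / a)"
proof -
  have "AE s in forest_law p. \<forall>i. \<exists>k. generation k (s i) > 1"
    using AE_forest_component[OF AE_excess] by (simp add: AE_all_countable)
  then show ?thesis
    using AE_forest_W by eventually_elim auto
qed

lemma excess_0: "excess 0 x = 0"
proof -
  interpret T: prob_space "tree_law p"
    by (rule prob_space_tree_law)
  have "AE \<nu> in tree_law p. \<nu> \<notin> {\<nu>. K \<nu> = 0 \<and> W \<nu> < x}"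
    using AE_excess
  proof eventually_elim
    case (elim \<nu>)
    then have "K \<nu> \<ge> 1"
      using K_pos by blast
    then show ?case
      by simp
  qed
  then show ?thesis
    unfolding excess_def by (subst T.prob_eq_0[OF sets_excess])
qed

text \<open>A first excess after generation 1 means a single root child. What hangs below it is a
  fresh tree with K lowered by one and the threshold multiplied by \<open>a\<close>.\<close>

lemma excess_Suc:
  assumes "k \<ge> 1"
  shows "excess (Suc k) x = q * excess k (a * x)"
proof -
  interpret T: prob_space "tree_law p"
    by (rule prob_space_tree_law)
  interpret F: prob_space "forest_law p"
    by (rule prob_space_forest_law)
  let ?A = "{\<nu>. K \<nu> = Suc k \<and> W \<nu> < x}"
  let ?B = "{\<nu>. K \<nu> = k \<and> W \<nu> < a * x}"
  have "ennreal (excess (Suc k) x) = (\<integral>\<^sup>+m. emeasure (forest_law p) {s. graft m s \<in> ?A} \<partial>measure_pmf p)"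
    using emeasure_tree_law(1)[OF sets_excess] by (simp add: excess_def T.emeasure_eq_measure)
  also have "\<dots> = (\<integral>\<^sup>+m. ennreal (excess k (a * x)) * indicator {1} m \<partial>measure_pmf p)"
  proof (intro nn_integral_cong_AE, unfold AE_measure_pmf_iff, intro ballI)
    fix m assume "m \<in> set_pmf p"
    then consider "m = 1" | "m \<ge> 2"
      using offspring_pos by fastforce
    then show "emeasure (forest_law p) {s. graft m s \<in> ?A} =
        ennreal (excess k (a * x)) * indicator {1} m"
    proof cases
      case 1
      have "emeasure (forest_law p) {s. graft m s \<in> ?A} = emeasure (forest_law p) {s. \<forall>i\<in>{0}. s i \<in> ?B}"
      proof (rule emeasure_eq_AE)
        show "AE s in forest_law p. s \<in> {s. graft m s \<in> ?A} \<longleftrightarrow> s \<in> {s. \<forall>i\<in>{0}. s i \<in> ?B}"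
          using AE_forest_regular
        proof eventually_elim
          case (elim s)
          then have "W (graft 1 s) = W (s 0) / a"
            by (simp add: lessThan_Suc)
          moreover have "K (graft 1 s) = Suc (K (s 0))"
            using elim K_graft_1 by blast
          ultimately show ?case
            using offspring_mean_gt_1 1 by (simp add: pos_divide_less_eq mult.commute)
        qed
        show "{s. \<forall>i\<in>{0}. s i \<in> ?B} \<in> sets (forest_law p)"
          using sets_excess[of k "a * x"]
            measurable_sets[OF measurable_component_singleton[of "0::nat" UNIV "\<lambda>_. tree_law p"], of ?B]
          by (simp add: vimage_def)
      qed (rule emeasure_tree_law(2)[OF sets_excess])
      also have "\<dots> = ennreal (excess k (a * x))"
        using emeasure_forest_inter[of "{0}", OF _ sets_excess]
        by (simp add: excess_def T.emeasure_eq_measure)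
      finally show ?thesis
        using 1 by simp
    next
      case 2
      then have empty: "{s. graft m s \<in> ?A} = {}"
        using K_graft_ge_2[of m] assms by auto
      show ?thesis
        unfolding empty using 2 by simp
    qed
  qed
  also have "\<dots> = ennreal (excess k (a * x) * q)"
    by (simp add: nn_integral_cmult emeasure_pmf_single ennreal_mult[symmetric] excess_nonneg)
  finally show ?thesis
    using pmf_1_pos by (subst (asm) ennreal_inj) (auto simp: excess_nonneg mult.commute)
qed

lemma excess_eq: "excess (Suc k) x = q ^ k * excess 1 (a ^ k * x)"
  by (induction k arbitrary: x) (simp_all add: excess_Suc ac_simps)

lemma excess_1_le: "excess 1 x \<le> (cdf_W (a * x))\<^sup>2"
proof -
  interpret T: prob_space "tree_law p"
    by (rule prob_space_tree_law)
  interpret F: prob_space "forest_law p"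
    by (rule prob_space_forest_law)
  let ?A = "{\<nu>. K \<nu> = 1 \<and> W \<nu> < x}"
  let ?B = "{\<nu>. W \<nu> < a * x}"
  have "emeasure (forest_law p) {s. graft m s \<in> ?A} \<le> ennreal ((cdf_W (a * x))\<^sup>2)"
    if "m \<in> set_pmf p" for m
  proof -
    have "emeasure (forest_law p) {s. graft m s \<in> ?A} \<le> emeasure (forest_law p) {s. \<forall>i\<in>{..<2}. s i \<in> ?B}"
    proof (rule emeasure_mono_AE)
      show "AE s in forest_law p. s \<in> {s. graft m s \<in> ?A} \<longrightarrow> s \<in> {s. \<forall>i\<in>{..<2}. s i \<in> ?B}"
        using AE_forest_regular
      proof eventually_elim
        case (elim s)
        show ?case
        proof
          assume A: "s \<in> {s. graft m s \<in> ?A}"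
          \<comment> \<open>A single root child would give K at least 2, by positivity of K in the
            subtree.\<close>
          have "m \<noteq> 1"
          proof
            assume "m = 1"
            obtain k where k: "generation k (s 0) > 1"
              using elim by blast
            show False
              using K_graft_1[of k s, OF k] K_pos[OF k] A \<open>m = 1\<close> by simp
          qed
          then have "m \<ge> 2"
            using offspring_pos[OF that] by simp
          then have "W (s i) \<le> (\<Sum>i<m. W (s i))" if "i < 2" for i
            using elim that by (intro member_le_sum) auto
          moreover have "(\<Sum>i<m. W (s i)) < a * x"
            using elim A offspring_mean_gt_1 by (auto simp: pos_divide_less_eq mult.commute)
          ultimately show "s \<in> {s. \<forall>i\<in>{..<2}. s i \<in> ?B}"
            by (auto intro: le_less_trans)
        qed
      qed
      have "{s \<in> space (forest_law p). \<forall>i\<in>{..<2}. s i \<in> ?B} \<in> sets (forest_law p)"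
        using sets_W_less[of "a * x"] by measurable
      then show "{s. \<forall>i\<in>{..<2}. s i \<in> ?B} \<in> sets (forest_law p)"
        by simp
    qed
    also have "\<dots> = ennreal ((cdf_W (a * x))\<^sup>2)"
      using emeasure_forest_inter[of "{..<2}", OF _ sets_W_less]
      by (simp add: cdf_W_def T.emeasure_eq_measure ennreal_power)
    finally show ?thesis .
  qed
  note forest = this
  have "ennreal (excess 1 x) = (\<integral>\<^sup>+m. emeasure (forest_law p) {s. graft m s \<in> ?A} \<partial>measure_pmf p)"
    using emeasure_tree_law(1)[OF sets_excess] by (simp add: excess_def T.emeasure_eq_measure)
  also have "\<dots> \<le> (\<integral>\<^sup>+m. ennreal ((cdf_W (a * x))\<^sup>2) \<partial>measure_pmf p)"
    by (intro nn_integral_mono_AE, unfold AE_measure_pmf_iff) (use forest in blast)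
  also have "\<dots> = ennreal ((cdf_W (a * x))\<^sup>2)"
    by (simp add: measure_pmf.emeasure_space_1[simplified])
  finally show ?thesis
    by simp
qed

text \<open>A root with \<open>m \<ge> 2\<close> children has K = 1, and it suffices to keep every
  subtree below the equal share \<open>a * x / m\<close>.\<close>

lemma excess_1_pos:
  assumes "x > 0"
  shows "excess 1 x > 0"
proof -
  interpret T: prob_space "tree_law p"
    by (rule prob_space_tree_law)
  interpret F: prob_space "forest_law p"
    by (rule prob_space_forest_law)
  obtain m where m: "m \<ge> 2" "pmf p m > 0"
    using two_offspring by blast
  let ?A = "{\<nu>. K \<nu> = 1 \<and> W \<nu> < x}"
  let ?B = "{\<nu>. W \<nu> < a * x / real m}"
  have "measure (forest_law p) {s. \<forall>i\<in>{..<m}. s i \<in> ?B} = cdf_W (a * x / real m) ^ m"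
    using emeasure_forest_inter[of "{..<m}", OF _ sets_W_less]
    by (simp add: cdf_W_def T.emeasure_eq_measure F.emeasure_eq_measure ennreal_power)
  moreover have "cdf_W (a * x / real m) > 0"
    using assms m offspring_mean_gt_1 by (intro cdf_W_pos) auto
  ultimately have "0 < measure (forest_law p) {s. \<forall>i\<in>{..<m}. s i \<in> ?B}"
    by simp
  also have "\<dots> \<le> measure (forest_law p) {s. graft m s \<in> ?A}"
  proof (rule F.finite_measure_mono_AE)
    show "AE s in forest_law p. s \<in> {s. \<forall>i\<in>{..<m}. s i \<in> ?B} \<longrightarrow> s \<in> {s. graft m s \<in> ?A}"
      using AE_forest_regular
    proof eventually_elim
      case (elim s)
      have "W (graft m s) < x" if "\<forall>i<m. W (s i) < a * x / real m"
      proof -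
        have "(\<Sum>i<m. W (s i)) < (\<Sum>i<m. a * x / real m)"
          using that m by (intro sum_strict_mono) (auto simp: lessThan_empty_iff bot_nat_def)
        then show ?thesis
          using elim m offspring_mean_gt_1 by (simp add: pos_divide_less_eq mult.commute)
      qed
      then show ?case
        using K_graft_ge_2[OF m(1)] by auto
    qed
  qed (rule emeasure_tree_law(2)[OF sets_excess])
  finally have "0 < pmf p m * measure (forest_law p) {s. graft m s \<in> ?A}"
    using m by simp
  also have "\<dots> \<le> excess 1 x"
    unfolding excess_def by (rule measure_tree_law_ge[OF sets_excess])
  finally show ?thesis .
qed

text \<open>For \<open>k \<ge> y\<close> the probability \<open>q ^ (k - 1)\<close> of the initial
  single line suffices. For \<open>k < y\<close> the square contributes the exponent
  \<open>y - k\<close> twice: once to complete \<open>q powr real k\<close> to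
  \<open>q powr y\<close>, once as decay. The division by \<open>q\<close> accounts for the exponent
  \<open>k - 1\<close>.\<close>

lemma excess_upper:
  assumes C: "C > 0" "\<And>y. cdf_W (a powr (- y)) \<le> C * q powr y"
  shows "excess k (a powr (- y)) \<le> (1 + C\<^sup>2) / q * q powr y * q powr \<bar>real k - y\<bar>"
proof (cases k)
  case 0
  then show ?thesis
    using pmf_1_pos by (simp add: excess_0)
next
  case (Suc j)
  have "q powr real k = q * q ^ j"
    unfolding Suc using pmf_1_pos by (subst powr_realpow) auto
  then have qj: "q ^ j = q powr real k / q"
    using pmf_1_pos by simp
  show ?thesis
  proof (cases "y \<le> real k")
    case True
    have "excess k (a powr (- y)) \<le> q ^ j * 1"
      unfolding Suc excess_eq using pmf_1_pos by (intro mult_left_mono excess_le_1) auto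
    also have "\<dots> = 1 / q * q powr y * q powr \<bar>real k - y\<bar>"
      unfolding qj using True by (simp add: powr_add[symmetric] mult.assoc)
    also have "\<dots> \<le> (1 + C\<^sup>2) / q * q powr y * q powr \<bar>real k - y\<bar>"
      using pmf_1_pos by (intro mult_right_mono divide_right_mono) auto
    finally show ?thesis .
  next
    case False
    have arg: "a * (a ^ j * a powr (- y)) = a powr (- (y - real k))"
      using offspring_mean_gt_1 Suc by (simp add: powr_diff powr_minus powr_realpow divide_inverse flip: of_nat_Suc)
    have "excess 1 (a ^ j * a powr (- y)) \<le> (cdf_W (a powr (- (y - real k))))\<^sup>2"
      using excess_1_le[of "a ^ j * a powr (- y)"] by (simp only: arg)
    also have "\<dots> \<le> (C * q powr (y - real k))\<^sup>2"
      by (intro power_mono C cdf_W_nonneg)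
    finally have "excess k (a powr (- y)) \<le> q ^ j * (C * q powr (y - real k))\<^sup>2"
      unfolding Suc excess_eq using pmf_1_pos by (intro mult_left_mono) (auto simp: Suc)
    also have "\<dots> = C\<^sup>2 / q * (q powr real k * q powr (y - real k) * q powr (y - real k))"
      unfolding qj by (simp add: power2_eq_square)
    also have "q powr real k * q powr (y - real k) * q powr (y - real k) = q powr y * q powr \<bar>real k - y\<bar>"
      using False by (simp add: powr_add[symmetric])
    also have "C\<^sup>2 / q * (q powr y * q powr \<bar>real k - y\<bar>) \<le> (1 + C\<^sup>2) / q * (q powr y * q powr \<bar>real k - y\<bar>)"
      using pmf_1_pos by (intro mult_right_mono divide_right_mono) auto
    finally show ?thesis
      by (simp add: mult.assoc)
  qed
qed

section \<open>Deviation bounds relative to the small-value probability\<close>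

lemma sets_deviation: "{\<nu>. x \<le> \<bar>real (K \<nu>) - y\<bar> \<and> W \<nu> < z} \<in> sets (tree_law p)"
proof -
  have "{\<nu> \<in> space (tree_law p). x \<le> \<bar>real (K \<nu>) - y\<bar> \<and> W \<nu> < z} \<in> sets (tree_law p)"
    by measurable
  then show ?thesis
    by simp
qed

lemma deviation_exponential:
  "\<exists>D>0. \<forall>y\<ge>0. \<forall>x. measure (tree_law p) {\<nu>. x \<le> \<bar>real (K \<nu>) - y\<bar> \<and> W \<nu> < a powr (- y)} \<le>
    D * sqrt q powr x * cdf_W (a powr (- y))"
proof -
  interpret T: prob_space "tree_law p"
    by (rule prob_space_tree_law)
  obtain C where C: "C > 0" "\<And>y. cdf_W (a powr (- y)) \<le> C * q powr y"
    using cdf_W_upper_powr by blast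
  obtain c where c: "c > 0" "\<And>y. y \<ge> 0 \<Longrightarrow> c * q powr y \<le> cdf_W (a powr (- y))"
    using cdf_W_lower_powr by blast
  \<comment> \<open>Half of the exponent yields the decay in \<open>x\<close>, the other half makes
    the sum over \<open>k\<close> converge; hence the rate \<open>sqrt q\<close>.\<close>
  define r where "r = sqrt q"
  have r: "0 < r" "r < 1" "q = r * r"
    using pmf_1_pos pmf_1_less by (simp_all add: r_def)
  define S where "S = 1 / (r * (1 - r)) + 1 / (1 - r)"
  define C' where "C' = (1 + C\<^sup>2) / q"
  have S: "S > 0"
    using r by (simp add: S_def add_pos_pos)
  have C': "C' > 0"
    using pmf_1_pos by (simp add: C'_def add_pos_nonneg)
  have "measure (tree_law p) {\<nu>. x \<le> \<bar>real (K \<nu>) - y\<bar> \<and> W \<nu> < a powr (- y)} \<le>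
      (C' * S / c) * sqrt q powr x * cdf_W (a powr (- y))" if y: "y \<ge> 0" for x y
  proof -
    define A where "A k = (if x \<le> \<bar>real k - y\<bar> then {\<nu>. K \<nu> = k \<and> W \<nu> < a powr (- y)} else {})" for k
    define f where "f k = C' * q powr y * r powr x * r powr \<bar>real k - y\<bar>" for k
    have A_le: "measure (tree_law p) (A k) \<le> f k" for k
    proof (cases "x \<le> \<bar>real k - y\<bar>")
      case True
      have "measure (tree_law p) (A k) \<le> C' * q powr y * q powr \<bar>real k - y\<bar>"
        using excess_upper[OF C, of k y] True by (simp add: A_def excess_def C'_def)
      also have "q powr \<bar>real k - y\<bar> = r powr \<bar>real k - y\<bar> * r powr \<bar>real k - y\<bar>"
        using r by (simp add: powr_mult)
      also have "\<dots> \<le> r powr x * r powr \<bar>real k - y\<bar>"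
        using r True by (intro mult_right_mono powr_mono') auto
      finally show ?thesis
        using C' by (simp add: f_def mult.assoc mult_left_mono)
    next
      case False
      then show ?thesis
        using C' by (simp add: A_def f_def)
    qed
    have f: "summable f" "suminf f \<le> C' * q powr y * r powr x * S"
    proof -
      note geo = two_sided_geometric[OF r(1,2) y, folded S_def]
      show "summable f"
        unfolding f_def by (intro summable_mult geo)
      have "suminf f = C' * q powr y * r powr x * (\<Sum>k. r powr \<bar>real k - y\<bar>)"
        unfolding f_def by (intro suminf_mult geo)
      also have "\<dots> \<le> C' * q powr y * r powr x * S"
        using C' by (intro mult_left_mono geo) auto
      finally show "suminf f \<le> C' * q powr y * r powr x * S" .
    qed
    have sum: "summable (\<lambda>k. measure (tree_law p) (A k))"
      by (rule summable_comparison_test'[OF f(1), of 0]) (use A_le in auto)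
    have A_sets: "range A \<subseteq> sets (tree_law p)"
      by (auto simp: A_def sets_excess)
    have "{\<nu>. x \<le> \<bar>real (K \<nu>) - y\<bar> \<and> W \<nu> < a powr (- y)} = (\<Union>k. A k)"
      by (auto simp: A_def)
    then have "measure (tree_law p) {\<nu>. x \<le> \<bar>real (K \<nu>) - y\<bar> \<and> W \<nu> < a powr (- y)} \<le>
        (\<Sum>k. measure (tree_law p) (A k))"
      using T.finite_measure_subadditive_countably[OF _ sum] by (simp only: A_sets)
    also have "\<dots> \<le> suminf f"
      by (intro suminf_le A_le sum f(1))
    also have "\<dots> \<le> C' * q powr y * r powr x * S"
      by (rule f(2))
    also have "\<dots> = (C' * S / c) * r powr x * (c * q powr y)"
      using c(1) by simp
    also have "\<dots> \<le> (C' * S / c) * r powr x * cdf_W (a powr (- y))"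
      using C' S c y by (intro mult_left_mono) auto
    finally show ?thesis
      by (simp add: r_def)
  qed
  moreover have "C' * S / c > 0"
    using C' S c by simp
  ultimately show ?thesis
    by blast
qed

text \<open>The integer obtained by rounding \<open>y\<close> up is at distance less than 1 from
  \<open>y\<close>, so the event that K equals it is disjoint from every deviation with
  \<open>x \<ge> 1\<close>. Its probability has the full order \<open>q powr y\<close>.\<close>

lemma deviation_lt_1:
  "\<exists>\<delta>>0. \<forall>y>0. \<forall>x\<ge>1. measure (tree_law p) {\<nu>. x \<le> \<bar>real (K \<nu>) - y\<bar> \<and> W \<nu> < a powr (- y)} \<le>
    (1 - \<delta>) * cdf_W (a powr (- y))"
proof -
  interpret T: prob_space "tree_law p"
    by (rule prob_space_tree_law)
  obtain C where C: "C > 0" "\<And>y. cdf_W (a powr (- y)) \<le> C * q powr y"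
    using cdf_W_upper_powr by blast
  \<comment> \<open>The quotient of the two constants in front of \<open>q powr y\<close>: the lower
    one for K at the rounded value, the upper one for the whole event that W is small.\<close>
  define \<delta> where "\<delta> = excess 1 (1 / a) / C"
  have "measure (tree_law p) {\<nu>. x \<le> \<bar>real (K \<nu>) - y\<bar> \<and> W \<nu> < a powr (- y)} \<le>
      (1 - \<delta>) * cdf_W (a powr (- y))" if y: "y > 0" and x: "x \<ge> 1" for x y
  proof -
    \<comment> \<open>\<open>Suc j\<close> is the ceiling of \<open>y\<close>, and positivity of
      \<open>y\<close> keeps the natural subtraction exact. As \<open>j\<close> exceeds
      \<open>y - 1\<close> or equals it, the threshold rescaled by \<open>a ^ j\<close> is at least
      \<open>1 / a\<close>.\<close>
    define j where "j = nat \<lceil>y\<rceil> - 1"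
    have j: "real j < y" "y \<le> real (Suc j)"
    proof -
      have "\<lceil>y\<rceil> > 0"
        using y by simp
      then have "nat \<lceil>y\<rceil> \<ge> 1"
        by linarith
      then have "real j = of_int \<lceil>y\<rceil> - 1"
        using y by (simp add: j_def of_nat_diff)
      then show "real j < y" "y \<le> real (Suc j)"
        by linarith+
    qed
    have "1 / a = a powr (- 1)"
      using offspring_mean_gt_1 by (simp add: powr_minus divide_inverse)
    also have "\<dots> \<le> a powr (real j - y)"
      using j offspring_mean_gt_1 by (intro powr_mono) auto
    also have "\<dots> = a ^ j * a powr (- y)"
      using offspring_mean_gt_1 by (simp add: powr_diff powr_minus powr_realpow divide_inverse)
    finally have "excess 1 (1 / a) \<le> excess 1 (a ^ j * a powr (- y))"
      by (rule excess_mono)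
    moreover have "q powr y \<le> q ^ j"
      using j pmf_1_pos pmf_1_less by (simp add: powr_realpow[symmetric] powr_mono')
    ultimately have "q powr y * excess 1 (1 / a) \<le> excess (Suc j) (a powr (- y))"
      unfolding excess_eq by (intro mult_mono) (auto simp: excess_nonneg)
    moreover have "\<delta> * cdf_W (a powr (- y)) \<le> \<delta> * (C * q powr y)"
      using C by (intro mult_left_mono C) (auto simp: \<delta>_def excess_nonneg)
    ultimately have "\<delta> * cdf_W (a powr (- y)) \<le> excess (Suc j) (a powr (- y))"
      using C(1) by (simp add: \<delta>_def mult.commute)
    moreover have "measure (tree_law p) {\<nu>. x \<le> \<bar>real (K \<nu>) - y\<bar> \<and> W \<nu> < a powr (- y)} +
        excess (Suc j) (a powr (- y)) \<le> cdf_W (a powr (- y))"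
    proof -
      have "{\<nu>. x \<le> \<bar>real (K \<nu>) - y\<bar> \<and> W \<nu> < a powr (- y)} \<inter>
          {\<nu>. K \<nu> = Suc j \<and> W \<nu> < a powr (- y)} = {}"
        using x j by auto
      then show ?thesis
        unfolding excess_def cdf_W_def
        by (subst T.finite_measure_Union[symmetric])
          (auto intro!: T.finite_measure_mono sets_deviation sets_excess sets_W_less)
    qed
    ultimately show ?thesis
      by (simp add: algebra_simps)
  qed
  moreover have "\<delta> > 0"
    using C excess_1_pos[of "1 / a"] offspring_mean_gt_1 by (simp add: \<delta>_def)
  ultimately show ?thesis
    by blast
qed

lemma conditional_deviation:
  "\<exists>\<theta>>0. \<forall>x\<ge>1. \<forall>\<epsilon>. 0 < \<epsilon> \<and> \<epsilon> < 1 \<longrightarrow>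
    measure (tree_law p) {\<nu>. x \<le> \<bar>real (K \<nu>) - gw_gamma p \<epsilon>\<bar> \<and> W \<nu> < \<epsilon>} /
    measure (tree_law p) {\<nu>. W \<nu> < \<epsilon>} \<le> exp (- \<theta> * x)"
proof -
  obtain D where D: "D > 0" "\<And>y x. y \<ge> 0 \<Longrightarrow>
      measure (tree_law p) {\<nu>. x \<le> \<bar>real (K \<nu>) - y\<bar> \<and> W \<nu> < a powr (- y)} \<le>
      D * sqrt q powr x * cdf_W (a powr (- y))"
    using deviation_exponential by blast
  obtain \<delta> where \<delta>: "\<delta> > 0" "\<And>y x. y > 0 \<Longrightarrow> x \<ge> 1 \<Longrightarrow>
      measure (tree_law p) {\<nu>. x \<le> \<bar>real (K \<nu>) - y\<bar> \<and> W \<nu> < a powr (- y)} \<le>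
      (1 - \<delta>) * cdf_W (a powr (- y))"
    using deviation_lt_1 by blast
  have sqrt_q: "0 < sqrt q" "sqrt q < 1"
    using pmf_1_pos pmf_1_less by simp_all
  obtain \<theta> where "\<theta> > 0" "\<forall>x\<ge>1. \<forall>P. P \<le> 1 - \<delta> \<longrightarrow> P \<le> D * sqrt q powr x \<longrightarrow> P \<le> exp (- \<theta> * x)"
    using exponential_bound[OF sqrt_q \<delta>(1) D(1)] by blast
  then have \<theta>: "\<theta> > 0" "\<And>x P. x \<ge> 1 \<Longrightarrow> P \<le> 1 - \<delta> \<Longrightarrow> P \<le> D * sqrt q powr x \<Longrightarrow> P \<le> exp (- \<theta> * x)"
    by simp_all
  have "measure (tree_law p) {\<nu>. x \<le> \<bar>real (K \<nu>) - gw_gamma p \<epsilon>\<bar> \<and> W \<nu> < \<epsilon>} /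
      measure (tree_law p) {\<nu>. W \<nu> < \<epsilon>} \<le> exp (- \<theta> * x)" if x: "x \<ge> 1" and \<epsilon>: "0 < \<epsilon>" "\<epsilon> < 1" for x \<epsilon>
  proof (rule \<theta>(2)[OF x])
    \<comment> \<open>Strict positivity of \<gamma>, from \<open>\<epsilon> < 1\<close>, is what
      \<open>deviation_lt_1\<close> requires.\<close>
    have y: "gw_gamma p \<epsilon> > 0" and eps: "\<epsilon> = a powr (- gw_gamma p \<epsilon>)"
      using \<epsilon> offspring_mean_gt_1 by (simp_all add: gw_gamma_def powr_def ln_div divide_neg_pos)
    have pos: "cdf_W \<epsilon> > 0"
      using \<epsilon> by (intro cdf_W_pos)
    show "measure (tree_law p) {\<nu>. x \<le> \<bar>real (K \<nu>) - gw_gamma p \<epsilon>\<bar> \<and> W \<nu> < \<epsilon>} /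
        measure (tree_law p) {\<nu>. W \<nu> < \<epsilon>} \<le> 1 - \<delta>"
      using \<delta>(2)[OF y x] pos unfolding eps[symmetric] by (simp add: cdf_W_def pos_divide_le_eq)
    show "measure (tree_law p) {\<nu>. x \<le> \<bar>real (K \<nu>) - gw_gamma p \<epsilon>\<bar> \<and> W \<nu> < \<epsilon>} /
        measure (tree_law p) {\<nu>. W \<nu> < \<epsilon>} \<le> D * sqrt q powr x"
      using D(2)[OF less_imp_le[OF y], of x] pos unfolding eps[symmetric]
      by (simp add: cdf_W_def pos_divide_le_eq)
  qed
  then show ?thesis
    using \<theta>(1) by blast
qed

end

section \<open>Transfer to an arbitrary Galton-Watson family\<close>

lemma distr_galton_watson:
  assumes "galton_watson M p N"
  shows "(\<lambda>\<omega> u. N u \<omega>) \<in> measurable M (tree_law p)"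
    and "distr M (tree_law p) (\<lambda>\<omega> u. N u \<omega>) = tree_law p"
proof -
  interpret prob_space M
    using assms by (simp add: galton_watson_def)
  have ind: "indep_vars (\<lambda>_. count_space UNIV) N UNIV"
    and law: "distr M (count_space UNIV) (N u) = measure_pmf p" for u
    using assms by (auto simp: galton_watson_def)
  have rv: "N u \<in> measurable M (count_space UNIV)" for u
    using ind by (auto simp: indep_vars_def)
  then show "(\<lambda>\<omega> u. N u \<omega>) \<in> measurable M (tree_law p)"
    by (intro measurable_tree_lawI)
  \<comment> \<open>Independence with a common law says precisely that the joint law of the family
    is the product law.\<close>
  have "distr M (Pi\<^sub>M UNIV (\<lambda>_. count_space UNIV)) (\<lambda>\<omega>. \<lambda>u\<in>UNIV. N u \<omega>) =
      Pi\<^sub>M UNIV (\<lambda>u. distr M (count_space UNIV) (N u))"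
    using ind rv by (subst (asm) indep_vars_iff_distr_eq_PiM) auto
  moreover have "sets (Pi\<^sub>M UNIV (\<lambda>_::nat list. count_space (UNIV :: nat set))) = sets (tree_law p)"
    by (intro sets_PiM_cong) auto
  ultimately show "distr M (tree_law p) (\<lambda>\<omega> u. N u \<omega>) = tree_law p"
    by (simp add: law restrict_def cong: distr_cong)
qed

theorem proposition1:
  fixes M :: "'a measure" and p :: "nat pmf" and N :: "nat list \<Rightarrow> 'a \<Rightarrow> nat"
  assumes "galton_watson M p N"
    and nondegenerate: "\<nexists>c. pmf p c = 1"
    and "pmf p 0 = 0"
    and "integrable (measure_pmf p) (\<lambda>n. real n * ln (real n))"
    and "min_offspring p = 1"
  shows "\<exists>\<theta>>0. \<forall>x\<ge>1.
    Limsup (at_right 0) (\<lambda>\<epsilon>. ereal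
      \<P>(\<omega> in M. (\<bar>real (gw_first_excess p N \<omega>) - gw_gamma p \<epsilon>\<bar> \<ge> x) \<bar> gw_limit p N \<omega> < \<epsilon>))
    \<le> ereal (exp (- \<theta> * x))"
proof -
  \<comment> \<open>Some value carries mass, so the \<open>LEAST\<close> in
    \<open>min_offspring\<close> is attained and \<open>min_offspring p = 1\<close> does give mass
    at 1.\<close>
  obtain n where "n \<in> set_pmf p"
    using set_pmf_not_empty[of p] by blast
  then have "pmf p (LEAST n. pmf p n > 0) > 0"
    using LeastI[of "\<lambda>n. pmf p n > 0" n] by (simp add: pmf_positive)
  then have "pmf p 1 > 0"
    using assms(5) by (simp add: min_offspring_def)
  moreover have "pmf p 1 < 1"
    using nondegenerate pmf_le_1[of p 1] by (meson le_neq_trans less_le)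
  ultimately interpret offspring_law p
    using assms by unfold_locales auto
  note N = distr_galton_watson[OF assms(1)]
  \<comment> \<open>K and W depend on the sample point only through the offspring family, so their
    joint law can be read off \<open>tree_law p\<close>.\<close>
  have K: "gw_first_excess p N \<omega> = K (\<lambda>u. N u \<omega>)" and W: "gw_limit p N \<omega> = W (\<lambda>u. N u \<omega>)" for \<omega>
    by (simp_all add: gw_first_excess_def gw_limit_def gw_size_def)
  have transfer: "\<P>(\<omega> in M. R (\<lambda>u. N u \<omega>)) = measure (tree_law p) {\<nu>. R \<nu>}"
    if "{\<nu>. R \<nu>} \<in> sets (tree_law p)" for R
    using measure_distr[OF N(1) that] by (simp add: N(2) vimage_def Int_def conj_commute)
  obtain \<theta> where \<theta>: "\<theta> > 0" "\<And>x \<epsilon>. x \<ge> 1 \<Longrightarrow> 0 < \<epsilon> \<Longrightarrow> \<epsilon> < 1 \<Longrightarrow>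
    measure (tree_law p) {\<nu>. x \<le> \<bar>real (K \<nu>) - gw_gamma p \<epsilon>\<bar> \<and> W \<nu> < \<epsilon>} /
    measure (tree_law p) {\<nu>. W \<nu> < \<epsilon>} \<le> exp (- \<theta> * x)"
    using conditional_deviation by blast
  have "Limsup (at_right 0) (\<lambda>\<epsilon>. ereal
      \<P>(\<omega> in M. (\<bar>real (gw_first_excess p N \<omega>) - gw_gamma p \<epsilon>\<bar> \<ge> x) \<bar> gw_limit p N \<omega> < \<epsilon>))
    \<le> ereal (exp (- \<theta> * x))" if "x \<ge> 1" for x
  proof (rule Limsup_bounded)
    have "eventually (\<lambda>\<epsilon>. 0 < \<epsilon> \<and> \<epsilon> < 1) (at_right (0::real))"
      unfolding eventually_at_right_field by (intro exI[of _ 1]) auto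
    then show "eventually (\<lambda>\<epsilon>. ereal
        \<P>(\<omega> in M. (\<bar>real (gw_first_excess p N \<omega>) - gw_gamma p \<epsilon>\<bar> \<ge> x) \<bar> gw_limit p N \<omega> < \<epsilon>)
        \<le> ereal (exp (- \<theta> * x))) (at_right 0)"
    proof eventually_elim
      case (elim \<epsilon>)
      then show ?case
        using \<theta>(2)[OF that, of \<epsilon>]
          transfer[OF sets_deviation[of x "gw_gamma p \<epsilon>" \<epsilon>]] transfer[OF sets_W_less[of \<epsilon>]]
        unfolding cond_prob_def K W by simp
    qed
  qed
  then show ?thesis
    using \<theta>(1) by blast
qed

end
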